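(* Suppose there exists a constant $C>0$ such that for all sufficiently large $X$, \[ \widetilde E(X)\ \le\ \tfrac{5}{6}\,\widetilde E(X^{3/4})\;+\;C\,X^{1/2}\log X . \] Then every nontrivial zero of the Riemann zeta function $\zeta(s)$ lies on the critical line $\Re(s)=\tfrac12$.
   Context: Let $\pi(m)$ be the number of primes $\le m$, $\psi$ the Chebyshev function $\psi(x)=\sum_{n\le x}\Lambda(n)$, and $E_\psi(y):=\psi(y)-y$. Let $\mathbb{N}_{\mathrm{comp}}$ denote the set of composite positive integers. The integer map $\mathcal{M}$ is defined by: for composite $m$, $\mathcal{M}(m)=m+\pi(m)$ (composites advance by $\pi(m)$); for a prime $p\ge 3$, $\mathcal{M}(p)=p-(p-p^-)=p^-$, where $p^-$ is the largest prime less than $p$ (primes step backward by their preceding prime gap). The trajectory of $y$ is the sequence $y_0=y$, $y_{j+1}=\mathcal{M}(y_j)$. For $X\ge 2$ put $W_X=[X,(1+0.1/\log X)X]$ and $\widetilde W_X=[X,(1+2/\log X)X]$, and let $\mathcal{T}(y;\widetilde W_X)$ denote the segment of the trajectory of $y$ lying inside $\widetilde W_X$. For large $X$ define \[ \widetilde E(X):=\sup_{y\in \widetilde W_X\cap\mathbb{N}_{\mathrm{comp}}}\Bigl|\sum_{\substack{m\in\mathcal{T}(y;\widetilde W_X)\\ m\in\mathbb{N}_{\mathrm{comp}}}} E_\psi(m)\Bigr| . \] *)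

theory Defs
  imports "HOL-Complex_Analysis.Complex_Analysis" "HOL-Number_Theory.Prime_Powers"
begin

text \<open>The Riemann zeta function: the unique function holomorphic on the punctured plane
  that agrees with the Dirichlet series sum of n powr (-s) for Re s > 1 (its analytic
  continuation). The value at the pole s = 1 is irrelevant and fixed to 0 only to make
  the description unique.\<close>
definition riemann_zeta :: "complex \<Rightarrow> complex" where
  "riemann_zeta = (THE f. f holomorphic_on (- {1}) \<and> f 1 = 0 \<and>
      (\<forall>s. 1 < Re s \<longrightarrow> f s = (\<Sum>n. of_nat (Suc n) powr (- s))))"

definition nontrivial_zeta_zero :: "complex \<Rightarrow> bool" where
  "nontrivial_zeta_zero s \<longleftrightarrow> s \<noteq> 1 \<and> riemann_zeta s = 0 \<and>
      (\<forall>n::nat. n \<ge> 1 \<longrightarrow> s \<noteq> - 2 * of_nat n)"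

definition prime_pi :: "nat \<Rightarrow> nat" where
  "prime_pi m = card {p. prime p \<and> p \<le> m}"

definition cheb_psi :: "real \<Rightarrow> real" where
  "cheb_psi x = (\<Sum>n\<in>{1..nat \<lfloor>x\<rfloor>}. mangoldt n)"

definition E_psi :: "real \<Rightarrow> real" where
  "E_psi y = cheb_psi y - y"

definition composite :: "nat \<Rightarrow> bool" where
  "composite m \<longleftrightarrow> m > 1 \<and> \<not> prime m"

definition prev_prime :: "nat \<Rightarrow> nat" where
  "prev_prime p = Max {q. prime q \<and> q < p}"

text \<open>The map M. It is only specified on composites and on primes p \<ge> 3;
  on 0, 1, 2 we (arbitrarily) let it be the identity; these values never matter.\<close>
definition M_map :: "nat \<Rightarrow> nat" where
  "M_map m = (if composite m then m + prime_pi m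
              else if prime m \<and> m \<ge> 3 then m - (m - prev_prime m)
              else m)"

definition trajectory :: "nat \<Rightarrow> nat \<Rightarrow> nat" where
  "trajectory y j = (M_map ^^ j) y"

definition Wt :: "real \<Rightarrow> nat set" where
  "Wt X = {m. X \<le> real m \<and> real m \<le> (1 + 2 / ln X) * X}"

definition traj_comp_in :: "nat \<Rightarrow> real \<Rightarrow> nat set" where
  "traj_comp_in y X = {m. (\<exists>j. trajectory y j = m) \<and> m \<in> Wt X \<and> composite m}"

definition E_tilde :: "real \<Rightarrow> real" where
  "E_tilde X = (SUP y\<in>{y. y \<in> Wt X \<and> composite y}.
                  \<bar>\<Sum>m\<in>traj_comp_in y X. E_psi (real m)\<bar>)"

end

theory Submission
  imports Defs "HOL-Probability.Characteristic_Functions" "HOL-Real_Asymp.Real_Asymp"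
begin

text \<open>
  A composite y at the top end of the window has a trajectory whose only composite member inside
  the window is y itself, since its successor leaves the window and later primes only step to
  primes. Hence \<open>E_tilde X\<close> dominates \<open>\<bar>E_psi y\<bar>\<close>, and iterating the assumed contraction gives
  \<open>\<psi>(n) - n = O(n\<^sup>1\<^sup>/\<^sup>2 log n)\<close>.

  By Abel summation the Dirichlet series with coefficients \<open>\<Lambda>(n) - 1\<close> then continues to a function H
  holomorphic on \<open>Re s > 1/2\<close>, and \<open>\<zeta>' = - \<zeta> (\<zeta> + H)\<close> holds there away from 1. A function solving
  such an equation cannot vanish at a point without vanishing identically, so \<open>\<zeta>\<close> has no zeros
  with \<open>Re s > 1/2\<close>.

  The remaining half plane is handled by Riemann's functional equation. It comes from the
  transformation law of the theta function, which in turn is Poisson summation for Gaussians: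
  both sides are continuous and have the same cosine coefficients on \<open>[0, 1/2]\<close>, and there
  polynomials in \<open>cos (2 \<pi> x)\<close> are dense.
\<close>

section \<open>Trajectories and the error term\<close>

text \<open>The parameter X of the window is real, so its right end sweeps through all large real
  values. In particular it hits every large composite integer exactly, and there a single term
  \<open>E_psi y\<close> is isolated. Primes are then reached from the even number before them.

  \<open>riemann_zeta\<close> is a definite description, so a continuation of the Dirichlet series
  must be exhibited before anything can be said about its zeros. Riemann's theta integral serves
  twice: it is an entire function, which yields the continuation, and it is invariant under s -> 1 -
  s, which yields the reflection of zeros. Its relation to the Dirichlet series is computed only for
  real arguments above 1, where all integrands are real and nonnegative, and the identity theorem
  carries it to complex s.\<close>

lemma finite_Wt: "finite (Wt X)"
proof (rule finite_subset)
  show "Wt X \<subseteq> {..nat \<lceil>(1 + 2 / ln X) * X\<rceil>}"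
    unfolding Wt_def by (auto, linarith)
qed simp

lemma not_composite_M_map:
  assumes "\<not> composite m"
  shows "\<not> composite (M_map m)"
proof (cases "prime m \<and> m \<ge> 3")
  case True
  have fin: "finite {q. prime q \<and> q < m}" by (rule finite_subset[of _ "{..<m}"]) auto
  have ne: "{q. prime q \<and> q < m} \<noteq> {}" using True by (auto intro!: exI[of _ 2])
  have "prev_prime m \<in> {q. prime q \<and> q < m}"
    unfolding prev_prime_def using fin ne by (rule Max_in)
  then show ?thesis using True assms by (auto simp: M_map_def composite_def)
next
  case False
  then show ?thesis using assms by (auto simp: M_map_def)
qed

lemma trajectory_Suc: "trajectory y (Suc j) = M_map (trajectory y j)"
  by (simp add: trajectory_def)

text \<open>Since primes step backward, a trajectory as a whole is not monotone. The disjunction is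
  what survives each step: being non-composite is absorbing, and a trajectory that is still
  composite has only moved forward.\<close>

lemma trajectory_not_composite_or_ge:
  assumes "composite y"
  shows "\<not> composite (trajectory y (Suc j)) \<or> y + prime_pi y \<le> trajectory y (Suc j)"
proof (induction j)
  case 0
  show ?case using assms by (simp add: trajectory_def M_map_def)
next
  case (Suc j)
  show ?case
  proof (cases "composite (trajectory y (Suc j))")
    case True
    then show ?thesis using Suc by (subst (2) trajectory_Suc) (auto simp: M_map_def)
  next
    case False
    then show ?thesis by (metis not_composite_M_map trajectory_Suc)
  qed
qed

lemma traj_comp_in_top:
  assumes "composite y" "y \<in> Wt X" "real (y + prime_pi y) > (1 + 2 / ln X) * X"
  shows "traj_comp_in y X = {y}"
proof -
  have "m = y" if "m \<in> traj_comp_in y X" for m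
  proof -
    from that obtain j where j: "trajectory y j = m" "m \<in> Wt X" "composite m"
      by (auto simp: traj_comp_in_def)
    show ?thesis
    proof (cases j)
      case 0
      then show ?thesis using j by (simp add: trajectory_def)
    next
      case (Suc i)
      then have "y + prime_pi y \<le> m"
        using trajectory_not_composite_or_ge[OF assms(1), of i] j by auto
      then have "real (y + prime_pi y) \<le> real m" by (simp only: of_nat_le_iff)
      then show ?thesis using assms(3) j(2) by (auto simp: Wt_def)
    qed
  qed
  moreover have "y \<in> traj_comp_in y X"
    using assms by (auto simp: traj_comp_in_def trajectory_def intro: exI[of _ 0])
  ultimately show ?thesis by blast
qed

text \<open>With \<open>y\<close> exactly at the right end, any positive jump leaves the window, and
  \<open>prime_pi y\<close> is positive because 2 is counted. The supremum is over a finite set,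
  hence an upper bound for each of its members.\<close>

lemma abs_E_psi_le_E_tilde:
  assumes "composite y" "y \<in> Wt X" "real y = (1 + 2 / ln X) * X"
  shows "\<bar>E_psi (real y)\<bar> \<le> E_tilde X"
proof -
  have "prime_pi y > 0"
    using assms(1) unfolding prime_pi_def
    by (subst card_gt_0_iff) (auto simp: composite_def intro!: exI[of _ 2])
  then have eq: "traj_comp_in y X = {y}"
    using assms by (intro traj_comp_in_top) auto
  have "\<bar>\<Sum>m\<in>traj_comp_in y X. E_psi (real m)\<bar> \<le> E_tilde X"
    unfolding E_tilde_def
  proof (rule cSUP_upper)
    show "y \<in> {y. y \<in> Wt X \<and> composite y}" using assms by simp
    show "bdd_above ((\<lambda>y. \<bar>\<Sum>m\<in>traj_comp_in y X. E_psi (real m)\<bar>) ` {y. y \<in> Wt X \<and> composite y})"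
      by (intro bdd_above_finite finite_imageI finite_subset[OF _ finite_Wt[of X]]) auto
  qed
  then show ?thesis by (simp add: eq)
qed

text \<open>Supplies the base case of the iteration. All windows with X between a and b lie in one
  finite set \<open>{..T}\<close>. As \<open>traj_comp_in y X\<close> is a set, each integer
  contributes at most once, so the sum of all absolute errors up to T bounds every trajectory
  sum.\<close>

lemma E_tilde_bounded_on_interval:
  assumes "a > 1"
  obtains B where "B \<ge> 0" "\<And>X. a \<le> X \<Longrightarrow> X \<le> b \<Longrightarrow> E_tilde X \<le> B"
proof -
  define T where "T = nat \<lceil>(1 + 2 / ln a) * b\<rceil>"
  define S where "S = (\<Sum>m\<le>T. \<bar>E_psi (real m)\<bar>)"
  define B where "B = max \<bar>Sup ({}::real set)\<bar> S"
  show ?thesis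
  proof (rule that[of B])
    show "B \<ge> 0" by (simp add: B_def)
    fix X assume X: "a \<le> X" "X \<le> b"
    have sub: "Wt X \<subseteq> {..T}"
    proof
      fix m assume "m \<in> Wt X"
      then have "real m \<le> (1 + 2 / ln X) * X" by (simp add: Wt_def)
      also have "\<dots> \<le> (1 + 2 / ln a) * b"
        using X assms by (intro mult_mono add_left_mono divide_left_mono) auto
      finally show "m \<in> {..T}" unfolding T_def by (simp, linarith)
    qed
    have bd: "\<bar>\<Sum>m\<in>traj_comp_in y X. E_psi (real m)\<bar> \<le> B" for y
    proof -
      have "\<bar>\<Sum>m\<in>traj_comp_in y X. E_psi (real m)\<bar> \<le> (\<Sum>m\<in>traj_comp_in y X. \<bar>E_psi (real m)\<bar>)"
        by (rule sum_abs)
      also have "\<dots> \<le> S" unfolding S_def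
        using sub by (intro sum_mono2) (auto simp: traj_comp_in_def)
      finally show ?thesis by (simp add: B_def)
    qed
    show "E_tilde X \<le> B"
    proof (cases "{y. y \<in> Wt X \<and> composite y} = {}")
      case True \<comment> \<open>no composite in the window: \<open>E_tilde\<close> takes the unspecified value \<open>Sup {}\<close>\<close>
      show ?thesis unfolding E_tilde_def True by (simp add: B_def)
    next
      case False
      then show ?thesis unfolding E_tilde_def using bd by (intro cSUP_least) auto
    qed
  qed
qed

section \<open>Iterating the contraction\<close>

text \<open>At X^(3/4) the comparison function X^(1/2) ln X becomes 3/4 X^(3/8) ln X, at most 3/4 of
  its value at X. A bound with constant K at X^(3/4) therefore gives the constant 5/6 * 3/4 * K + C
  = 5/8 K + C at X. The descent X -> X^(3/4) is organised as induction on n over the ranges up to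
  X0^((4/3)^n).\<close>

lemma contraction_iterate:
  fixes F :: "real \<Rightarrow> real"
  assumes bounded: "\<And>a b. a > 1 \<Longrightarrow> \<exists>B\<ge>0. \<forall>X. a \<le> X \<longrightarrow> X \<le> b \<longrightarrow> F X \<le> B"
    and "C > 0"
    and ev: "\<forall>\<^sub>F X in at_top. F X \<le> 5/6 * F (X powr (3/4)) + C * X powr (1/2) * ln X"
  obtains K where "K > 0" "\<forall>\<^sub>F X in at_top. F X \<le> K * (X powr (1/2) * ln X)"
proof -
  obtain X1 where X1: "\<And>X. X \<ge> X1 \<Longrightarrow> F X \<le> 5/6 * F (X powr (3/4)) + C * X powr (1/2) * ln X"
    using ev unfolding eventually_at_top_linorder by blast
  define X0 where "X0 = max X1 3"
  \<comment> \<open>For X > X0 the point X^(3/4) is still at least a, so one descent never leaves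
    the range on which the bound is being proved.\<close>
  define a where "a = X0 powr (3/4)"
  have X0: "X0 \<ge> 3" "X0 \<ge> X1" by (auto simp: X0_def)
  have a: "a > 1" unfolding a_def using X0 by (intro gr_one_powr) auto
  obtain B where B: "B \<ge> 0" "\<And>X. a \<le> X \<Longrightarrow> X \<le> X0 \<Longrightarrow> F X \<le> B"
    using bounded[OF a] by metis
  define m where "m = a powr (1/2) * ln a"
  have m: "m > 0" using a by (simp add: m_def)
  \<comment> \<open>\<open>8 * C / 3\<close> is the least K with 5/8 K + C <= K.
    \<open>B / m\<close> settles the interval from a to X0, where m is the minimum of the comparison
    function.\<close>
  define K where "K = max (8 * C / 3) (B / m)"
  have K: "K \<ge> 8 * C / 3" "K * m \<ge> B" "K > 0"
    using m \<open>C > 0\<close> by (simp_all add: K_def pos_divide_le_eq[symmetric] less_max_iff_disj)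
  have main: "F X \<le> K * (X powr (1/2) * ln X)" if "a \<le> X" "X \<le> X0 powr ((4/3)^n)" for n X
    using that
  proof (induction n arbitrary: X)
    case 0
    have "m \<le> X powr (1/2) * ln X" unfolding m_def
      using a 0 by (intro mult_mono powr_mono2) auto
    then have "K * m \<le> K * (X powr (1/2) * ln X)" using K by simp
    moreover have "F X \<le> B" using 0 X0 by (intro B) auto
    ultimately show ?case using K by linarith
  next
    case (Suc n)
    show ?case
    proof (cases "X \<le> X0")
      case True
      also have "X0 \<le> X0 powr ((4/3)^n)"
        using powr_mono[of 1 "(4/3)^n" X0] X0 by simp
      finally show ?thesis using Suc.prems(1) Suc.IH by blast
    next
      case False
      have Xp: "X > 1" using False X0 by auto
      have l: "a \<le> X powr (3/4)" unfolding a_def using False X0 by (intro powr_mono2) auto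
      have "X powr (3/4) \<le> (X0 powr ((4/3)^Suc n)) powr (3/4)"
        using Suc.prems Xp by (intro powr_mono2) auto
      also have "\<dots> = X0 powr ((4/3)^n)" by (simp add: powr_powr)
      finally have "F (X powr (3/4)) \<le> K * ((X powr (3/4)) powr (1/2) * ln (X powr (3/4)))"
        using l Suc.IH by blast
      also have "\<dots> = K * (3/4) * (X powr (3/8) * ln X)"
        using Xp by (simp add: powr_powr ln_powr)
      also have "\<dots> \<le> K * (3/4) * (X powr (1/2) * ln X)"
        using K Xp by (intro mult_left_mono mult_right_mono powr_mono) auto
      finally have "5/6 * F (X powr (3/4)) \<le> 5/8 * K * (X powr (1/2) * ln X)"
        by (simp add: mult_ac)
      moreover have "F X \<le> 5/6 * F (X powr (3/4)) + C * (X powr (1/2) * ln X)"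
        using X1[of X] False X0 by (simp add: mult.assoc)
      ultimately have "F X \<le> (5/8 * K + C) * (X powr (1/2) * ln X)"
        by (simp add: algebra_simps)
      also have "\<dots> \<le> K * (X powr (1/2) * ln X)"
        using K Xp by (intro mult_right_mono) auto
      finally show ?thesis .
    qed
  qed
  have "F X \<le> K * (X powr (1/2) * ln X)" if "X \<ge> X0" for X
  proof -
    have a_le: "a \<le> X" using powr_mono[of "3/4" 1 X0] X0 that by (auto simp: a_def)
    \<comment> \<open>On a logarithmic scale the ranges grow geometrically, so every X is eventually
      covered.\<close>
    obtain n where n: "ln X / ln X0 < (4/3)^n"
      using real_arch_pow[of "4/3" "ln X / ln X0"] by auto
    have "ln X \<le> (4/3)^n * ln X0" using n X0 by (simp add: field_simps)
    then have "exp (ln X) \<le> exp ((4/3)^n * ln X0)" by simp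
    then have "X \<le> X0 powr ((4/3)^n)"
      using X0 that by (simp add: powr_def)
    then show ?thesis using main a_le by blast
  qed
  then show ?thesis using that[OF K(3)] unfolding eventually_at_top_linorder by blast
qed

lemma cheb_psi_Suc: "cheb_psi (real (Suc n)) = cheb_psi (real n) + mangoldt (Suc n)"
  unfolding cheb_psi_def by (simp only: floor_of_nat nat_int) simp

lemma E_psi_bound:
  assumes "\<exists>C::real. C > 0 \<and>
    (\<forall>\<^sub>F X in at_top.
       E_tilde X \<le> 5/6 * E_tilde (X powr (3/4)) + C * X powr (1/2) * ln X)"
  obtains K where "K > 0" "\<forall>\<^sub>F n in sequentially. \<bar>E_psi (real n)\<bar> \<le> K * (real n powr (1/2) * ln (real n))"
proof -
  obtain C where C: "C > 0" "\<forall>\<^sub>F X in at_top.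
       E_tilde X \<le> 5/6 * E_tilde (X powr (3/4)) + C * X powr (1/2) * ln X"
    using assms by blast
  have bdd: "\<exists>B\<ge>0. \<forall>X. a \<le> X \<longrightarrow> X \<le> b \<longrightarrow> E_tilde X \<le> B" if "a > 1" for a b
    by (rule E_tilde_bounded_on_interval[OF that, of b]) blast
  obtain K where K: "K > 0" "\<forall>\<^sub>F X in at_top. E_tilde X \<le> K * (X powr (1/2) * ln X)"
    using contraction_iterate[of E_tilde, OF bdd C] by blast
  obtain X1 where X1: "\<And>X. X \<ge> X1 \<Longrightarrow> E_tilde X \<le> K * (X powr (1/2) * ln X)"
    using K unfolding eventually_at_top_linorder by blast
  define X0 where "X0 = max X1 3"
  have X0: "X0 \<ge> 3" "X0 \<ge> X1" by (auto simp: X0_def)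
  \<comment> \<open>The margin 6 leaves room for the predecessor of n: the claim for composites is
    stated for \<open>n + 1 \<ge> N0\<close> so that it also applies to n - 1. It also makes ln n at
    least 1.\<close>
  define N0 where "N0 = nat \<lceil>(1 + 2 / ln X0) * X0\<rceil> + 6"
  have comp: "\<bar>E_psi (real n)\<bar> \<le> K * (real n powr (1/2) * ln (real n))"
    if "n + 1 \<ge> N0" "composite n" for n
  proof -
    have n1: "(1 + 2 / ln X0) * X0 \<le> real n" using that(1) unfolding N0_def by linarith
    have "X0 \<le> (1 + 2 / ln X0) * X0" using X0 by (simp add: field_simps)
    then have n2: "X0 \<le> real n" using n1 by linarith
    have n3: "real n \<le> (1 + 2 / ln (real n)) * real n" using n2 X0 by (simp add: field_simps)
    \<comment> \<open>The right end of the window depends continuously on X. It is at most n for X =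
      X0 and at least n for X = n, so some X in between has its right end exactly at n.\<close>
    have "continuous_on {X0..real n} (\<lambda>X. (1 + 2 / ln X) * X)"
      using X0 by (intro continuous_intros) auto
    then obtain X where X: "X0 \<le> X" "X \<le> real n" "(1 + 2 / ln X) * X = real n"
      using IVT'[of "\<lambda>X. (1 + 2 / ln X) * X" X0 "real n" "real n"] n1 n2 n3 by auto
    have "\<bar>E_psi (real n)\<bar> \<le> E_tilde X"
      using that X by (intro abs_E_psi_le_E_tilde) (auto simp: Wt_def)
    also have "\<dots> \<le> K * (X powr (1/2) * ln X)" using X X0 by (intro X1) auto
    also have "\<dots> \<le> K * (real n powr (1/2) * ln (real n))"
      using X X0 K by (intro mult_left_mono mult_mono powr_mono2) auto
    finally show ?thesis .
  qed
  have "\<bar>E_psi (real n)\<bar> \<le> (K + 2) * (real n powr (1/2) * ln (real n))" if n: "n \<ge> N0" for n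
  proof -
    have n6: "n \<ge> 6" using n by (simp add: N0_def)
    have ln1: "ln (real n) \<ge> 1" using n6 ln_ge_iff[of "real n" 1] exp_le by auto
    have p1: "real n powr (1/2) \<ge> 1" using n6 by (intro ge_one_powr_ge_zero) auto
    define L where "L = real n powr (1/2) * ln (real n)"
    have ln2: "L \<ge> ln (real n)" using ln1 p1 by (simp add: L_def)
    show ?thesis
    proof (cases "prime n")
      case False
      then have "\<bar>E_psi (real n)\<bar> \<le> K * (real n powr (1/2) * ln (real n))"
        using n n6 by (intro comp) (auto simp: composite_def)
      then show ?thesis using ln1 ln2 unfolding L_def[symmetric] by (simp add: distrib_right)
    next
      case True
      then have odd: "odd n" using n6 prime_odd_nat by auto
      obtain k where k: "n = Suc k" using n6 by (cases n) auto
      \<comment> \<open>A prime n >= 6 is odd, so k = n - 1 is even and larger than 2. Passing from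
        k to n changes \<open>E_psi\<close> by ln n - 1, which the extra constant 2 absorbs.\<close>
      have "composite k"
        using odd n6 k prime_odd_nat[of k] by (auto simp: composite_def)
      then have "\<bar>E_psi (real k)\<bar> \<le> K * (real k powr (1/2) * ln (real k))"
        using n k by (intro comp) auto
      also have "\<dots> \<le> K * (real n powr (1/2) * ln (real n))"
        using k n6 K by (intro mult_left_mono mult_mono powr_mono2) auto
      finally have "\<bar>E_psi (real k)\<bar> \<le> K * (real n powr (1/2) * ln (real n))" .
      moreover have "E_psi (real n) = E_psi (real k) + ln (real n) - 1"
        using True cheb_psi_Suc[of k] unfolding E_psi_def k by simp
      ultimately show ?thesis using ln1 ln2 unfolding L_def[symmetric] by (simp add: distrib_right)
    qed
  qed
  then show ?thesis using K by (intro that[of "K + 2"]) (auto simp: eventually_at_top_linorder)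
qed

section \<open>The Dirichlet series of the zeta function\<close>

lemma norm_nat_powr [simp]: "norm (of_nat n powr s :: complex) = real n powr Re s"
  by (subst norm_powr_real_powr) auto

lemma nat_mult_powr: "of_nat (m * n) powr (s::complex) = of_nat m powr s * of_nat n powr s"
  by (simp add: powr_times_real)

lemma summable_Suc_powr: "s < -1 \<Longrightarrow> summable (\<lambda>n. real (Suc n) powr s)"
  using summable_real_powr_iff[of s] summable_Suc_iff[of "\<lambda>n. real n powr s"] by simp

lemma summable_ln_Suc_powr:
  assumes "s < -1"
  shows "summable (\<lambda>n. ln (real (Suc n)) * real (Suc n) powr s)"
proof (rule summable_comparison_test)
  define d where "d = (- 1 - s) / 2"
  have d: "d > 0" using assms by (simp add: d_def)
  show "\<exists>N. \<forall>n\<ge>N. norm (ln (real (Suc n)) * real (Suc n) powr s) \<le> inverse d * real (Suc n) powr (s + d)"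
  proof (intro exI[of _ 0] allI impI)
    fix n :: nat
    have "ln (real (Suc n)) * real (Suc n) powr s \<le> (real (Suc n) powr d / d) * real (Suc n) powr s"
      using d by (intro mult_right_mono ln_powr_bound) auto
    also have "\<dots> = inverse d * real (Suc n) powr (s + d)"
      by (simp add: powr_add field_simps)
    finally show "norm (ln (real (Suc n)) * real (Suc n) powr s) \<le> inverse d * real (Suc n) powr (s + d)"
      by simp
  qed
  have "s + d < -1" using assms by (simp add: d_def field_simps)
  then show "summable (\<lambda>n. inverse d * real (Suc n) powr (s + d))"
    by (intro summable_mult summable_Suc_powr)
qed

lemma Suc_powr_has_derivative:
  "((\<lambda>s. of_nat (Suc n) powr (- s)) has_field_derivative
     - (of_real (ln (real (Suc n))) * of_nat (Suc n) powr (- s) :: complex)) (at s)"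
proof -
  have "of_nat (Suc n) \<noteq> (0::complex)" by (simp only: of_nat_eq_0_iff)
  then show ?thesis
    unfolding powr_def Ln_of_nat[of "Suc n", simplified]
    by (auto intro!: derivative_eq_intros simp: Ln_of_nat simp del: of_nat_Suc)
qed

lemma zeta_series_has_derivative:
  assumes "Re s > 1"
  shows "((\<lambda>s. \<Sum>n. of_nat (Suc n) powr (- s)) has_field_derivative
           - (\<Sum>n. of_real (ln (real (Suc n))) * of_nat (Suc n) powr (- s))) (at s)"
proof -
  let ?S = "{s. Re s > 1}"
  let ?f = "\<lambda>n s. of_nat (Suc n) powr (- s) :: complex"
  let ?f' = "\<lambda>n s. - (of_real (ln (real (Suc n))) * of_nat (Suc n) powr (- s)) :: complex"
  have S: "open ?S" by (rule open_halfspace_Re_gt)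
  note d = Suc_powr_has_derivative
  have "\<exists>g g'. \<forall>x \<in> ?S. ((\<lambda>n. ?f n x) sums g x) \<and> ((\<lambda>n. ?f' n x) sums g' x) \<and> (g has_field_derivative g' x) (at x)"
  proof (rule series_and_derivative_comparison_complex[OF S d])
    fix x assume x: "x \<in> ?S"
    \<comment> \<open>Half the distance to the line Re s = 1: on the ball of radius e all exponents
      are at most -1 - e, which gives one summable majorant.\<close>
    define e where "e = (Re x - 1) / 2"
    have e: "e > 0" using x by (simp add: e_def)
    have le: "norm (?f n y) \<le> real (Suc n) powr (- 1 - e)" if "y \<in> ball x e" for n y
    proof -
      have "\<bar>Re (x - y)\<bar> < e" using that abs_Re_le_cmod[of "x - y"] by (simp add: dist_norm)
      then have "- Re y \<le> - 1 - e" by (simp add: e_def field_simps abs_if split: if_splits)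
      then have "real (Suc n) powr (- Re y) \<le> real (Suc n) powr (- 1 - e)"
        by (intro powr_mono) auto
      then show ?thesis by (simp del: of_nat_Suc)
    qed
    show "\<exists>d h. 0 < d \<and> summable h \<and> range h \<subseteq> \<real>\<^sub>\<ge>\<^sub>0 \<and>
             (\<forall>\<^sub>F n in sequentially. \<forall>y\<in>ball x d \<inter> ?S. cmod (?f n y) \<le> cmod (h n))"
    proof (intro exI[of _ e] exI[of _ "\<lambda>n. of_real (real (Suc n) powr (- 1 - e)) :: complex"] conjI)
      show "summable (\<lambda>n. of_real (real (Suc n) powr (- 1 - e)) :: complex)"
        unfolding summable_of_real_iff using e by (intro summable_Suc_powr) auto
      show "\<forall>\<^sub>F n in sequentially. \<forall>y\<in>ball x e \<inter> ?S. cmod (?f n y) \<le> cmod (of_real (real (Suc n) powr (- 1 - e)) :: complex)"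
        using le by (intro always_eventually) (auto simp del: of_nat_Suc)
    qed (use e in auto)
  qed
  then obtain g g' where g: "\<And>x. x \<in> ?S \<Longrightarrow> ((\<lambda>n. ?f n x) sums g x)"
    "\<And>x. x \<in> ?S \<Longrightarrow> ((\<lambda>n. ?f' n x) sums g' x)"
    "\<And>x. x \<in> ?S \<Longrightarrow> (g has_field_derivative g' x) (at x)" by blast
  have s: "s \<in> ?S" using assms by simp
  have "((\<lambda>s. \<Sum>n. of_nat (Suc n) powr (- s)) has_field_derivative g' s) (at s)"
    using g(3)[OF s] S s
  proof (rule has_field_derivative_transform_within_open)
    show "g x = (\<Sum>n. of_nat (Suc n) powr (- x))" if "x \<in> ?S" for x
      using g(1)[OF that] by (simp add: sums_iff)
  qed
  moreover have "g' s = - (\<Sum>n. of_real (ln (real (Suc n))) * of_nat (Suc n) powr (- s))"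
    using sums_minus[OF g(2)[OF s]] by (simp add: sums_iff)
  ultimately show ?thesis by simp
qed

text \<open>The Dirichlet product is rearranged with unordered sums over the positive integers,
  whereas the zeta series is indexed through \<open>Suc n\<close>. This bijection moves results
  between the two forms.\<close>

lemma bij_betw_Suc_positive: "bij_betw Suc UNIV {1..}"
  by (rule bij_betwI[of _ _ _ "\<lambda>n. n - 1"]) auto

lemma has_sum_positive_imp_sums:
  assumes "(f has_sum x) {1::nat..}"
  shows "(\<lambda>n. f (Suc n)) sums x"
proof (rule has_sum_imp_sums)
  show "((\<lambda>n. f (Suc n)) has_sum x) UNIV"
    unfolding has_sum_reindex_bij_betw[OF bij_betw_Suc_positive, of f x] by (rule assms)
qed

lemma abs_summable_on_positive:
  fixes f :: "nat \<Rightarrow> 'a :: banach"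
  assumes "summable (\<lambda>n. norm (f (Suc n)))"
  shows "(\<lambda>n. norm (f n)) summable_on {1..}"
proof -
  have "(\<lambda>n. norm (f (Suc n))) summable_on UNIV"
    using assms by (intro norm_summable_imp_summable_on) simp
  then show ?thesis
    using summable_on_reindex_bij_betw[OF bij_betw_Suc_positive, of "\<lambda>n. norm (f n)"] by simp
qed

lemma mangoldt_powr_abs_summable:
  assumes "Re s > 1"
  shows "summable (\<lambda>n. norm (mangoldt (Suc n) * of_nat (Suc n) powr (- s) :: complex))"
proof (rule summable_comparison_test)
  show "summable (\<lambda>n. ln (real (Suc n)) * real (Suc n) powr (- Re s))"
    using assms by (intro summable_ln_Suc_powr) simp
  show "\<exists>N. \<forall>n\<ge>N. norm (norm (mangoldt (Suc n) * of_nat (Suc n) powr (- s) :: complex))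
      \<le> ln (real (Suc n)) * real (Suc n) powr (- Re s)"
    by (intro exI[of _ 0]) (auto simp: norm_mult mangoldt_le abs_mult intro!: mult_right_mono simp del: of_nat_Suc)
qed

text \<open>The identity sum over d | n of Lambda(d) = ln n in Dirichlet series form. The absolutely
  convergent double sum over (d, k) is regrouped by the product n = d k, keeping the divisor d as
  second coordinate.\<close>

lemma zeta_mult_mangoldt_series:
  assumes "Re s > 1"
  shows "(\<Sum>n. mangoldt (Suc n) * of_nat (Suc n) powr (- s) :: complex) * (\<Sum>n. of_nat (Suc n) powr (- s))
       = (\<Sum>n. of_real (ln (real (Suc n))) * of_nat (Suc n) powr (- s))"
proof -
  let ?P = "{1::nat..}"
  let ?f = "\<lambda>n. mangoldt n * of_nat n powr (- s) :: complex"
  let ?g = "\<lambda>n. of_nat n powr (- s) :: complex"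
  let ?h = "\<lambda>(d, k). ?f d * ?g k"
  have f: "(\<lambda>n. norm (?f n)) summable_on ?P"
    using assms by (intro abs_summable_on_positive mangoldt_powr_abs_summable)
  have "summable (\<lambda>n. norm (?g (Suc n)))"
    using assms by (simp del: of_nat_Suc add: summable_Suc_powr)
  then have g: "(\<lambda>n. norm (?g n)) summable_on ?P" by (rule abs_summable_on_positive)
  obtain F where F: "(?f has_sum F) ?P" using abs_summable_summable[OF f] by (auto simp: summable_on_def)
  obtain G where G: "(?g has_sum G) ?P" using abs_summable_summable[OF g] by (auto simp: summable_on_def)
  have "(\<lambda>x. norm (?h x)) summable_on (?P \<times> ?P)"
    unfolding Infinite_Sum.abs_summable_on_Sigma_iff
  proof (intro conjI ballI)
    show "(\<lambda>y. norm (?h (x, y))) summable_on ?P" for x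
      using summable_on_cmult_right[OF g, of "norm (?f x)"] by (simp add: norm_mult)
    have "(\<Sum>\<^sub>\<infinity>y\<in>?P. norm (?h (x, y))) = norm (?f x) * (\<Sum>\<^sub>\<infinity>y\<in>?P. norm (?g y))" for x
      using infsum_cmult_right'[of "norm (?f x)" "\<lambda>y. norm (?g y)" ?P] by (simp add: norm_mult)
    moreover have "(\<Sum>\<^sub>\<infinity>y\<in>?P. norm (?g y)) \<ge> 0" by (rule infsum_nonneg) simp
    ultimately show "(\<lambda>x. norm (\<Sum>\<^sub>\<infinity>y\<in>?P. norm (?h (x, y)))) summable_on ?P"
      using summable_on_cmult_left[OF f, of "\<Sum>\<^sub>\<infinity>y\<in>?P. norm (?g y)"] by (simp add: abs_mult norm_mult)
  qed
  then have h: "?h summable_on (?P \<times> ?P)" by (rule abs_summable_summable)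
  have "(?h has_sum (F * G)) (?P \<times> ?P)"
  proof (rule has_sum_SigmaI[OF _ _ h])
    show "((\<lambda>y. ?h (x, y)) has_sum (?f x * G)) ?P" for x
      using has_sum_cmult_right[OF G] by simp
    show "((\<lambda>x. ?f x * G) has_sum (F * G)) ?P"
      using has_sum_cmult_left[OF F] by simp
  qed
  also have "(?h has_sum (F * G)) (?P \<times> ?P) \<longleftrightarrow>
     ((\<lambda>(n, d). mangoldt d * of_nat n powr (- s)) has_sum (F * G)) (Sigma ?P (\<lambda>n. {d. d dvd n}))"
  proof (rule has_sum_reindex_bij_witness[where j = "\<lambda>(d, k). (d * k, d)" and i = "\<lambda>(n, d). (d, n div d)"])
    fix a assume "a \<in> ?P \<times> ?P"
    then show "(\<lambda>(n, d). mangoldt d * of_nat n powr (- s)) ((\<lambda>(d, k). (d * k, d)) a) = ?h a"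
      by (auto simp: nat_mult_powr mult_ac simp del: of_nat_mult)
  qed (auto simp: Suc_le_eq dvd_div_eq_0_iff intro: Nat.gr0I)
  finally have "((\<lambda>n. of_real (ln (real n)) * of_nat n powr (- s)) has_sum (F * G)) ?P"
  proof (rule has_sum_SigmaD)
    fix n :: nat assume "n \<in> ?P"
    then have n: "n \<noteq> 0" by auto
    have "((\<lambda>d. mangoldt d * of_nat n powr (- s)) has_sum
            (\<Sum>d | d dvd n. mangoldt d * of_nat n powr (- s))) {d. d dvd n}"
      using n by (intro has_sum_finite) auto
    also have "(\<Sum>d | d dvd n. mangoldt d * of_nat n powr (- s)) = of_real (ln (real n)) * of_nat n powr (- s)"
      by (simp add: mangoldt_sum[OF n, symmetric] sum_distrib_right)
    finally show "((\<lambda>d. case (n, d) of (n, d) \<Rightarrow> mangoldt d * of_nat n powr (- s)) has_sum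
         of_real (ln (real n)) * of_nat n powr (- s)) {d. d dvd n}" by simp
  qed
  note H = has_sum_positive_imp_sums[OF this]
  show ?thesis
    using H has_sum_positive_imp_sums[OF F] has_sum_positive_imp_sums[OF G]
    by (simp add: sums_iff del: of_nat_Suc)
qed

section \<open>Abel summation and continuation of Dirichlet series\<close>

text \<open>Mean value inequality: the derivative of z^(-s) has norm |s| |z|^(-Re s - 1) on the
  positive axis, largest at the left end of the segment. The extra power of 1/n is what Abel
  summation gains.\<close>

lemma norm_powr_diff_Suc_le:
  assumes "Re s > 0"
  shows "norm (of_nat (Suc n) powr (- s) - of_nat (Suc (Suc n)) powr (- s) :: complex)
           \<le> norm s * real (Suc n) powr (- Re s - 1)"
proof -
  let ?a = "of_nat (Suc n) :: complex" and ?b = "of_nat (Suc (Suc n)) :: complex"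
  have "norm (?a powr (- s) - ?b powr (- s)) \<le> (norm s * real (Suc n) powr (- Re s - 1)) * norm (?a - ?b)"
  proof (rule field_differentiable_bound[where S = "closed_segment ?a ?b" and f' = "\<lambda>z. - s * z powr (- s - 1)"])
    fix z assume z: "z \<in> closed_segment ?a ?b"
    then obtain u where u: "0 \<le> u" "u \<le> 1" "z = (1 - u) *\<^sub>R ?a + u *\<^sub>R ?b"
      by (auto simp: closed_segment_def)
    have z': "z = of_real (real (Suc n) + u)" unfolding u(3) by (simp add: scaleR_conv_of_real algebra_simps)
    have "z \<notin> \<real>\<^sub>\<le>\<^sub>0" using u(1) by (simp add: z' complex_nonpos_Reals_iff)
    then show "((\<lambda>z. z powr (- s)) has_field_derivative - s * z powr (- s - 1)) (at z within closed_segment ?a ?b)"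
      by (auto intro!: derivative_eq_intros)
    have "norm (z powr (- s - 1)) = (real (Suc n) + u) powr (- Re s - 1)"
      unfolding z' using u by (subst norm_powr_real_powr) auto
    also have "\<dots> \<le> real (Suc n) powr (- Re s - 1)"
      using u assms by (intro powr_mono2') auto
    finally show "norm (- s * z powr (- s - 1)) \<le> norm s * real (Suc n) powr (- Re s - 1)"
      by (simp add: norm_mult mult_left_mono del: of_nat_Suc)
  qed auto
  then show ?thesis by simp
qed


lemma abel_summation_powr:
  fixes a :: "nat \<Rightarrow> complex" and s :: complex
  defines "A \<equiv> \<lambda>n. \<Sum>k<n. a k"
  shows "(\<Sum>k<n. a k * of_nat (Suc k) powr (- s)) =
     A n * of_nat (Suc n) powr (- s) +
     (\<Sum>k<n. A (Suc k) * (of_nat (Suc k) powr (- s) - of_nat (Suc (Suc k)) powr (- s)))"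
proof (induction n)
  case (Suc n)
  have A: "A (Suc n) = A n + a n" by (simp add: A_def)
  show ?case unfolding sum.lessThan_Suc Suc.IH unfolding A by (simp only: algebra_simps)
qed (simp add: A_def)

text \<open>After Abel summation the terms are O(n^(b - Re s - 1)) locally uniformly, so the
  transformed series defines H on the whole half plane. Agreement with any value of the original
  series is what later ties H to the region Re s > 1.\<close>

lemma dirichlet_series_continuation:
  fixes a :: "nat \<Rightarrow> complex" and b K :: real
  defines "A \<equiv> \<lambda>n. \<Sum>k<n. a k"
  assumes b: "0 \<le> b"
    and A: "\<forall>\<^sub>F n in sequentially. norm (A n) \<le> K * real n powr b"
  obtains H where "H holomorphic_on {s. Re s > b}"
    "\<And>s l. Re s > b \<Longrightarrow> (\<lambda>n. a n * of_nat (Suc n) powr (- s)) sums l \<Longrightarrow> H s = l"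
proof -
  let ?S = "{s. Re s > b}"
  let ?f = "\<lambda>n s. A (Suc n) * (of_nat (Suc n) powr (- s) - of_nat (Suc (Suc n)) powr (- s))"
  have S: "open ?S" by (rule open_halfspace_Re_gt)
  have A': "\<forall>\<^sub>F n in sequentially. norm (A (Suc n)) \<le> K * real (Suc n) powr b"
    using A by (rule eventually_compose_filterlim[OF _ filterlim_Suc])
  obtain H where H: "\<And>x. x \<in> ?S \<Longrightarrow> (\<lambda>n. ?f n x) sums H x"
    "\<And>x. x \<in> ?S \<Longrightarrow> H field_differentiable (at x)"
  proof (rule series_differentiable_comparison_complex[OF S, of ?f])
    fix n x
    show "?f n field_differentiable (at x)"
      unfolding field_differentiable_def
      by (rule exI, rule DERIV_cmult[OF DERIV_diff[OF Suc_powr_has_derivative Suc_powr_has_derivative]])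
  next
    fix x assume x: "x \<in> ?S"
    define e where "e = (Re x - b) / 2"
    have e: "e > 0" using x by (simp add: e_def)
    define B where "B = \<bar>K\<bar> * (norm x + e)"
    have le: "norm (?f n y) \<le> B * real (Suc n) powr (- 1 - e)"
      if n: "norm (A (Suc n)) \<le> K * real (Suc n) powr b" and y: "y \<in> ball x e" for n y
    proof -
      have "\<bar>Re (x - y)\<bar> < e" using y abs_Re_le_cmod[of "x - y"] by (simp add: dist_norm)
      then have y1: "Re y \<ge> b + e" by (simp add: e_def field_simps abs_if split: if_splits)
      have y2: "norm y \<le> norm x + e"
        using y norm_triangle_ineq2[of y x] by (simp add: dist_norm norm_minus_commute)
      have "norm (?f n y) \<le> (K * real (Suc n) powr b) * (norm y * real (Suc n) powr (- Re y - 1))"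
        unfolding norm_mult using n y1 b e order_trans[OF norm_ge_zero n]
        by (intro mult_mono norm_powr_diff_Suc_le) auto
      also have "\<dots> \<le> (\<bar>K\<bar> * real (Suc n) powr b) * ((norm x + e) * real (Suc n) powr (- (b + e) - 1))"
        using y1 y2 e by (intro mult_mono powr_mono) auto
      also have "\<dots> = B * real (Suc n) powr (b + (- (b + e) - 1))"
        unfolding powr_add B_def by (simp add: mult_ac)
      also have "b + (- (b + e) - 1) = - 1 - e" by simp
      finally show ?thesis .
    qed
    have B: "B \<ge> 0" using e by (simp add: B_def)
    show "\<exists>d h. 0 < d \<and> summable h \<and> range h \<subseteq> \<real>\<^sub>\<ge>\<^sub>0 \<and>
             (\<forall>\<^sub>F n in sequentially. \<forall>y\<in>ball x d \<inter> ?S. cmod (?f n y) \<le> cmod (h n))"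
    proof (intro exI[of _ e] exI[of _ "\<lambda>n. of_real (B * real (Suc n) powr (- 1 - e)) :: complex"] conjI)
      show "summable (\<lambda>n. of_real (B * real (Suc n) powr (- 1 - e)) :: complex)"
        unfolding summable_of_real_iff using e by (intro summable_mult summable_Suc_powr) auto
      show "\<forall>\<^sub>F n in sequentially. \<forall>y\<in>ball x e \<inter> ?S. cmod (?f n y) \<le> cmod (of_real (B * real (Suc n) powr (- 1 - e)) :: complex)"
        using A'
      proof eventually_elim
        case (elim n)
        show ?case
        proof
          fix y assume "y \<in> ball x e \<inter> ?S"
          then have "norm (?f n y) \<le> B * real (Suc n) powr (- 1 - e)" using elim by (intro le) auto
          also have "\<dots> = cmod (of_real (B * real (Suc n) powr (- 1 - e)) :: complex)"
            unfolding norm_of_real using B by (intro abs_of_nonneg[symmetric]) auto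
          finally show "norm (?f n y) \<le> cmod (of_real (B * real (Suc n) powr (- 1 - e)) :: complex)" .
        qed
      qed
    qed (use e B in auto)
  qed blast
  show ?thesis
  proof (rule that[of H])
    show "H holomorphic_on ?S"
      using H(2) by (auto simp: holomorphic_on_def intro: field_differentiable_at_within)
    fix s l assume s: "Re s > b" and l: "(\<lambda>n. a n * of_nat (Suc n) powr (- s)) sums l"
    \<comment> \<open>The boundary term of Abel summation is O(n^(b - Re s)) and disappears in the
      limit.\<close>
    have "(\<lambda>n. A (Suc n) * of_nat (Suc (Suc n)) powr (- s)) \<longlonglongrightarrow> 0"
    proof (rule Lim_null_comparison)
      show "\<forall>\<^sub>F n in sequentially. norm (A (Suc n) * of_nat (Suc (Suc n)) powr (- s)) \<le> \<bar>K\<bar> * real (Suc n) powr (b - Re s)"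
        using A'
      proof eventually_elim
        case (elim n)
        have "norm (A (Suc n) * of_nat (Suc (Suc n)) powr (- s)) \<le> (\<bar>K\<bar> * real (Suc n) powr b) * real (Suc (Suc n)) powr (- Re s)"
          unfolding norm_mult norm_nat_powr using elim
          by (intro mult_mono) (auto intro: order_trans[OF elim] mult_right_mono)
        also have "\<dots> \<le> (\<bar>K\<bar> * real (Suc n) powr b) * real (Suc n) powr (- Re s)"
          using s b by (intro mult_left_mono powr_mono2') auto
        also have "\<dots> = \<bar>K\<bar> * real (Suc n) powr (b - Re s)" 
          using powr_add[of "real (Suc n)" b "- Re s"] by (simp add: mult_ac)
        finally show ?case .
      qed
      have "(\<lambda>n. real (Suc n) powr (b - Re s)) \<longlonglongrightarrow> 0"
        using s by (intro tendsto_neg_powr filterlim_compose[OF filterlim_real_sequentially filterlim_Suc]) auto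
      then show "(\<lambda>n. \<bar>K\<bar> * real (Suc n) powr (b - Re s)) \<longlonglongrightarrow> 0"
        by (rule tendsto_mult_right_zero)
    qed
    then have "(\<lambda>n. A n * of_nat (Suc n) powr (- s)) \<longlonglongrightarrow> 0"
      by (subst (asm) filterlim_sequentially_Suc[of "\<lambda>n. A n * of_nat (Suc n) powr (- s)"])
    moreover have "(\<lambda>n. \<Sum>k<n. ?f k s) \<longlonglongrightarrow> H s"
      using H(1)[of s] s by (simp add: sums_def)
    ultimately have "(\<lambda>n. A n * of_nat (Suc n) powr (- s) + (\<Sum>k<n. ?f k s)) \<longlonglongrightarrow> 0 + H s"
      by (rule tendsto_add)
    then have "(\<lambda>n. a n * of_nat (Suc n) powr (- s)) sums H s"
      unfolding sums_def abel_summation_powr A_def by simp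
    then show "H s = l" using l by (metis sums_unique2)
  qed
qed

section \<open>Zero-free region from a differential equation\<close>

text \<open>D need not be simply connected, so h is integrated only on a ball around z. With a
  primitive G there, f exp(-G) is constant; a zero at the centre makes f vanish on the ball, and the
  identity theorem spreads this to w.\<close>

lemma log_deriv_zero_free:
  fixes f :: "complex \<Rightarrow> complex"
  assumes D: "open D" "connected D"
    and f: "f holomorphic_on D" and h: "h holomorphic_on D"
    and ode: "\<And>z. z \<in> D \<Longrightarrow> deriv f z = f z * h z"
    and w: "w \<in> D" "f w \<noteq> 0" and z: "z \<in> D"
  shows "f z \<noteq> 0"
proof
  assume fz: "f z = 0"
  obtain r where r: "r > 0" "ball z r \<subseteq> D" using D z open_contains_ball by blast
  obtain G where G: "\<And>x. x \<in> ball z r \<Longrightarrow> (G has_field_derivative h x) (at x within ball z r)"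
    by (rule holomorphic_convex_primitive'[OF convex_ball open_ball holomorphic_on_subset[OF h r(2)]]) blast
  have G': "(G has_field_derivative h x) (at x)" if "x \<in> ball z r" for x
    using G[OF that] unfolding at_within_open[OF that open_ball] .
  have "((\<lambda>x. f x * exp (- G x)) has_field_derivative 0) (at x within ball z r)" if x: "x \<in> ball z r" for x
  proof -
    have xD: "x \<in> D" using r x by blast
    have "(f has_field_derivative f x * h x) (at x)"
      using holomorphic_derivI[OF f D(1) xD] unfolding ode[OF xD] .
    from DERIV_mult[OF this DERIV_fun_exp[OF DERIV_minus[OF G'[OF x]]]]
    have "((\<lambda>x. f x * exp (- G x)) has_field_derivative 0) (at x)" by (simp add: mult_ac)
    then show ?thesis by (rule has_field_derivative_at_within)
  qed
  from has_field_derivative_zero_constant[OF convex_ball this]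
  obtain c where c: "\<And>x. x \<in> ball z r \<Longrightarrow> f x * exp (- G x) = c" by blast
  have "f x * exp (- G x) = f z * exp (- G z)" if "x \<in> ball z r" for x
    using c[OF that] c[of z] r by simp
  then have zero: "f x = 0" if "x \<in> ball z r" for x using that fz by simp
  have "f w = 0"
    using analytic_continuation_open[of "ball z r" D f "\<lambda>_. 0" w] zero D f w r by auto
  then show False using w by simp
qed

text \<open>For Re s > 1, -f' is f times the Dirichlet series of Lambda, and that series is f + H.
  Splitting off f keeps H regular at 1, so any singularity there sits in f alone and the equation
  makes sense on the half plane with 1 removed.\<close>

lemma zeta_zero_free:
  fixes f :: "complex \<Rightarrow> complex" and b K :: real
  assumes f: "f holomorphic_on (- {1})"
    and fs: "\<And>s. Re s > 1 \<Longrightarrow> f s = (\<Sum>n. of_nat (Suc n) powr (- s))"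
    and b: "0 \<le> b" "b < 1"
    and E: "\<forall>\<^sub>F n in sequentially. \<bar>E_psi (real n)\<bar> \<le> K * real n powr b"
    and s: "Re s > b" "s \<noteq> 1"
  shows "f s \<noteq> 0"
proof -
  \<comment> \<open>\<open>a n\<close> belongs to the integer \<open>Suc n\<close>, so summing over
    k < n collects Lambda(m) - 1 for m from 1 to n, which is exactly \<open>E_psi n\<close>.\<close>
  define a :: "nat \<Rightarrow> complex" where "a = (\<lambda>n. mangoldt (Suc n) - 1)"
  have A: "(\<Sum>k<n. a k) = of_real (E_psi (real n))" for n
    unfolding a_def E_psi_def cheb_psi_def
    by (simp add: sum_subtractf sum.atLeast1_atMost_eq)
  have "\<forall>\<^sub>F n in sequentially. norm (\<Sum>k<n. a k) \<le> K * real n powr b"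
    using E by (simp add: A)
  then obtain H where H: "H holomorphic_on {s. Re s > b}"
    "\<And>s l. Re s > b \<Longrightarrow> (\<lambda>n. a n * of_nat (Suc n) powr (- s)) sums l \<Longrightarrow> H s = l"
    using dirichlet_series_continuation[OF b(1)] by blast
  define D where "D = {s. Re s > b} - {1}"
  have oD: "open D" unfolding D_def by (intro open_Diff open_halfspace_Re_gt) auto
  have cD: "connected D" unfolding D_def
    by (intro connected_open_delete open_halfspace_Re_gt convex_connected convex_halfspace_Re_gt) auto
  have fD: "f holomorphic_on D" using f by (rule holomorphic_on_subset) (auto simp: D_def)
  have HD: "H holomorphic_on D" using H(1) by (rule holomorphic_on_subset) (auto simp: D_def)
  have ode: "deriv f z = - f z * (f z + H z)" if z: "Re z > 1" for z
  proof -
    let ?m = "\<Sum>n. mangoldt (Suc n) * of_nat (Suc n) powr (- z) :: complex"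
    have m: "(\<lambda>n. mangoldt (Suc n) * of_nat (Suc n) powr (- z)) sums ?m"
      by (rule summable_sums[OF summable_norm_cancel[OF mangoldt_powr_abs_summable[OF z]]])
    have "summable (\<lambda>n. norm (of_nat (Suc n) powr (- z) :: complex))"
      using z by (simp del: of_nat_Suc add: summable_Suc_powr)
    then have 1: "(\<lambda>n. of_nat (Suc n) powr (- z)) sums f z"
      unfolding fs[OF z] by (rule summable_sums[OF summable_norm_cancel])
    have "(\<lambda>n. a n * of_nat (Suc n) powr (- z)) sums (?m - f z)"
      using sums_diff[OF m 1] by (simp add: a_def algebra_simps del: of_nat_Suc)
    then have Hz: "H z = ?m - f z" using z b by (intro H(2)) auto
    have "((\<lambda>s. \<Sum>n. of_nat (Suc n) powr (- s)) has_field_derivative - (?m * f z)) (at z)"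
      using zeta_series_has_derivative[OF z] zeta_mult_mangoldt_series[OF z] fs[OF z] by simp
    then have "(f has_field_derivative - (?m * f z)) (at z)"
      by (rule has_field_derivative_transform_within_open[where S = "{s. Re s > 1}"])
         (use z fs in \<open>auto simp: open_halfspace_Re_gt\<close>)
    then show ?thesis using Hz by (simp add: DERIV_imp_deriv)
  qed
  \<comment> \<open>Both sides are holomorphic on the connected set D and agree on the half plane Re
    z > 1 inside it.\<close>
  have ode': "deriv f z = - f z * (f z + H z)" if "z \<in> D" for z
  proof (rule analytic_continuation_open[of "{s. Re s > 1}" D "deriv f" "\<lambda>z. - f z * (f z + H z)"])
    show "{s. Re s > 1} \<noteq> {}" by (auto intro!: exI[of _ 2])
    show "{s. Re s > 1} \<subseteq> D" using b by (auto simp: D_def)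
    show "deriv f holomorphic_on D" using fD oD by (rule holomorphic_deriv)
    show "(\<lambda>z. - f z * (f z + H z)) holomorphic_on D" using fD HD by (intro holomorphic_intros)
  qed (use oD cD ode that in \<open>auto simp: open_halfspace_Re_gt\<close>)
  have "Re (f 2) = (\<Sum>n. real (Suc n) powr (- 2))"
  proof -
    have eq: "of_nat (Suc n) powr (- 2) = complex_of_real (real (Suc n) powr (- 2))" for n
      by (subst powr_of_real[symmetric]) auto
    have "(\<lambda>n. complex_of_real (real (Suc n) powr (- 2))) sums of_real (\<Sum>n. real (Suc n) powr (- 2))"
      by (intro sums_of_real summable_sums summable_Suc_powr) auto
    then show ?thesis by (simp add: fs eq sums_iff del: of_nat_Suc)
  qed
  also have "\<dots> > 0" by (intro suminf_pos summable_Suc_powr) auto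
  finally have f2: "f 2 \<noteq> 0" by auto
  show ?thesis
  proof (rule log_deriv_zero_free[OF oD cD fD _ _ _ f2, where h = "\<lambda>z. - (f z + H z)"])
    show "(\<lambda>z. - (f z + H z)) holomorphic_on D" using fD HD by (intro holomorphic_intros)
    show "deriv f z = f z * - (f z + H z)" if "z \<in> D" for z
      using ode'[OF that] by (simp add: algebra_simps)
  qed (use s b in \<open>auto simp: D_def\<close>)
qed

section \<open>The theta function\<close>

text \<open>Real part of the characteristic function of the standard normal distribution.\<close>

lemma integral_std_normal_cos:
  "(LINT x|lborel. std_normal_density x * cos (a * x)) = exp (- a\<^sup>2 / 2)"
  "integrable lborel (\<lambda>x. std_normal_density x * cos (a * x))"
proof -
  interpret real_distribution std_normal_distribution by (rule real_dist_normal_dist)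
  have "(LINT x|std_normal_distribution. iexp (a * x)) = complex_of_real (exp (- a\<^sup>2 / 2))"
    using fun_cong[OF char_std_normal_distribution, of a] by (simp add: char_def)
  moreover have int: "integrable std_normal_distribution (\<lambda>x. iexp (a * x))"
    by (rule integrable_iexp) auto
  ultimately have "(LINT x|std_normal_distribution. Re (iexp (a * x))) = exp (- a\<^sup>2 / 2)"
    by (subst integral_Re) auto
  then show "(LINT x|lborel. std_normal_density x * cos (a * x)) = exp (- a\<^sup>2 / 2)"
    by (subst (asm) integral_density) (auto simp: Re_exp)
  have "integrable std_normal_distribution (\<lambda>x. Re (iexp (a * x)))"
    using int by (rule integrable_Re)
  then show "integrable lborel (\<lambda>x. std_normal_density x * cos (a * x))"
    by (subst (asm) integrable_density) (auto simp: Re_exp)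
qed

text \<open>The scaling by c = sqrt(2 pi t) reduces to the standard normal density, and evenness
  halves the integral over the line. The limit runs over integers N because the unfolding of cosine
  coefficients produces the integrals over 0..N as partial sums.\<close>

lemma integral_gaussian_cos_tendsto:
  fixes t b :: real
  assumes t: "t > 0"
  shows "(\<lambda>N. integral {0..real N} (\<lambda>u. exp (- pi * t * u\<^sup>2) * cos (2 * pi * b * u)))
           \<longlonglongrightarrow> exp (- pi * b\<^sup>2 / t) / (2 * sqrt t)"
proof -
  define c where "c = sqrt (2 * pi * t)"
  define a where "a = 2 * pi * b / c"
  let ?g = "\<lambda>u. exp (- pi * t * u\<^sup>2) * cos (2 * pi * b * u)"
  let ?f = "\<lambda>x. std_normal_density x * cos (a * x)"
  have c: "c > 0" "c\<^sup>2 = 2 * pi * t" using t by (auto simp: c_def)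
  have g: "?g u = sqrt (2 * pi) * ?f (c * u)" for u
    using c by (simp add: std_normal_density_def a_def power_mult_distrib mult.assoc)
  have int: "integrable lborel ?g"
    unfolding g using lborel_integrable_real_affine[OF integral_std_normal_cos(2)[of a], of c 0] c by simp
  have "(LINT u|lborel. ?g u) = sqrt (2 * pi) * (LINT u|lborel. ?f (c * u))"
    unfolding g by simp
  also have "(LINT u|lborel. ?f (c * u)) = exp (- a\<^sup>2 / 2) / c"
    using lborel_integral_real_affine[of c ?f 0] c integral_std_normal_cos(1)[of a] by (simp add: field_simps)
  also have "sqrt (2 * pi) * (exp (- a\<^sup>2 / 2) / c) = exp (- a\<^sup>2 / 2) / sqrt t"
    using t by (simp add: c_def real_sqrt_mult)
  also have "- a\<^sup>2 / 2 = - pi * b\<^sup>2 / t"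
    using t c unfolding a_def by (simp add: power_divide power_mult_distrib field_simps power2_eq_square)
  finally have val: "(LINT u|lborel. ?g u) = exp (- pi * b\<^sup>2 / t) / sqrt t" .
  have int': "integrable lborel (\<lambda>u. indicator {0..} u *\<^sub>R ?g u)"
    using int by (intro integrable_mult_indicator) auto
  have "has_bochner_integral lborel ?g (2 *\<^sub>R (LINT u|lborel. indicator {0..} u *\<^sub>R ?g u))"
    by (rule has_bochner_integral_even_function[OF has_bochner_integral_integrable[OF int']]) simp
  then have half: "(LINT u|lborel. indicator {0..} u *\<^sub>R ?g u) = exp (- pi * b\<^sup>2 / t) / (2 * sqrt t)"
    using val by (simp add: has_bochner_integral_iff)
  have "((\<lambda>y. LINT u|lborel. indicator {..y} u *\<^sub>R (indicator {0..} u *\<^sub>R ?g u))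
           \<longlongrightarrow> exp (- pi * b\<^sup>2 / t) / (2 * sqrt t)) at_top"
    using tendsto_integral_at_top[OF _ int'] half by simp
  then have "(\<lambda>N. LINT u|lborel. indicator {..real N} u *\<^sub>R (indicator {0..} u *\<^sub>R ?g u))
           \<longlonglongrightarrow> exp (- pi * b\<^sup>2 / t) / (2 * sqrt t)"
    by (rule filterlim_compose[OF _ filterlim_real_sequentially])
  moreover have "(LINT u|lborel. indicator {..real N} u *\<^sub>R (indicator {0..} u *\<^sub>R ?g u)) = integral {0..real N} ?g" for N
  proof -
    have "set_integrable lborel {0..real N} ?g"
      by (intro borel_integrable_atLeastAtMost' continuous_intros)
    from set_borel_integral_eq_integral(2)[OF this]
    have "integral {0..real N} ?g = (LINT u|lborel. indicator {0..real N} u *\<^sub>R ?g u)"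
      by (simp add: set_lebesgue_integral_def)
    also have "\<dots> = (LINT u|lborel. indicator {..real N} u *\<^sub>R (indicator {0..} u *\<^sub>R ?g u))"
      by (intro Bochner_Integration.integral_cong) (auto simp: indicator_def)
    finally show ?thesis by simp
  qed
  ultimately show ?thesis by simp
qed

lemma integral_sums_M_test:
  fixes f :: "nat \<Rightarrow> real \<Rightarrow> 'a :: banach"
  assumes cont: "\<And>n. continuous_on {a..b} (f n)"
    and le: "\<And>n x. x \<in> {a..b} \<Longrightarrow> norm (f n x) \<le> M n"
    and M: "summable M"
  shows "continuous_on {a..b} (\<lambda>x. \<Sum>n. f n x)"
    and "(\<lambda>n. integral {a..b} (f n)) sums integral {a..b} (\<lambda>x. \<Sum>n. f n x)"
proof -
  have u: "uniform_limit {a..b} (\<lambda>n x. \<Sum>i<n. f i x) (\<lambda>x. \<Sum>n. f n x) sequentially"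
    using le M by (rule Weierstrass_m_test)
  have c: "continuous_on {a..b} (\<lambda>x. \<Sum>i<n. f i x)" for n
    using cont by (intro continuous_intros)
  show "continuous_on {a..b} (\<lambda>x. \<Sum>n. f n x)"
    by (rule uniform_limit_theorem[OF _ u]) (use c in auto)
  obtain I J where IJ: "\<And>n. ((\<lambda>x. \<Sum>i<n. f i x) has_integral I n) {a..b}"
    "((\<lambda>x. \<Sum>n. f n x) has_integral J) {a..b}" "I \<longlonglongrightarrow> J"
    by (rule uniform_limit_integral[OF u c]) auto
  have "I = (\<lambda>n. \<Sum>i<n. integral {a..b} (f i))"
  proof
    fix n show "I n = (\<Sum>i<n. integral {a..b} (f i))"
      using integral_unique[OF IJ(1)[of n]] cont
      by (subst (asm) integral_sum) (auto intro: integrable_continuous_real)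
  qed
  then have "(\<lambda>n. integral {a..b} (f n)) sums J" using IJ(3) by (simp add: sums_def)
  then show "(\<lambda>n. integral {a..b} (f n)) sums integral {a..b} (\<lambda>x. \<Sum>n. f n x)"
    using IJ(2) by (simp add: integral_unique)
qed

section \<open>Completeness of the cosines on [0, 1/2]\<close>

text \<open>The product formula for cosines turns vanishing coefficients into vanishing moments
  against powers of cos (2 pi x). Since u = cos (2 pi x) maps [0, 1/2] bijectively onto [-1, 1],
  Weierstrass approximation in u shows that the integral of h^2 is zero.\<close>

lemma cos_coeffs_zero_imp_zero:
  fixes h :: "real \<Rightarrow> real"
  assumes cont: "continuous_on {0..1/2} h"
    and zero: "\<And>k::nat. integral {0..1/2} (\<lambda>x. h x * cos (2 * pi * real k * x)) = 0"
    and x: "x \<in> {0..1/2}"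
  shows "h x = 0"
proof -
  let ?I = "{0..1/2::real}"
  have contk: "continuous_on ?I (\<lambda>x. h x * cos (2 * pi * real j * x) * cos (2 * pi * x) ^ k)" for j k
    using cont by (intro continuous_intros)
  have mom: "integral ?I (\<lambda>x. h x * cos (2 * pi * real j * x) * cos (2 * pi * x) ^ k) = 0" for j k
  proof (induction k arbitrary: j)
    case 0
    then show ?case using zero by simp
  next
    case (Suc k)
    \<comment> \<open>The index \<open>if j = 0 then 1 else j - 1\<close> is |j - 1|: cosine is
      even, so frequency -1 counts as 1.\<close>
    have *: "h x * cos (2 * pi * real j * x) * cos (2 * pi * x) ^ Suc k
        = (h x * cos (2 * pi * real (j + 1) * x) * cos (2 * pi * x) ^ k
           + h x * cos (2 * pi * real (if j = 0 then 1 else j - 1) * x) * cos (2 * pi * x) ^ k) / 2" for x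
    proof -
      have "cos (2 * pi * real j * x) * cos (2 * pi * x)
          = (cos (2 * pi * real j * x - 2 * pi * x) + cos (2 * pi * real j * x + 2 * pi * x)) / 2"
        by (rule cos_times_cos)
      also have "2 * pi * real j * x + 2 * pi * x = 2 * pi * real (j + 1) * x" by (simp add: algebra_simps)
      also have "cos (2 * pi * real j * x - 2 * pi * x) = cos (2 * pi * real (if j = 0 then 1 else j - 1) * x)"
        by (cases j) (auto simp: algebra_simps)
      finally have "cos (2 * pi * real j * x) * cos (2 * pi * x)
         = (cos (2 * pi * real (if j = 0 then 1 else j - 1) * x) + cos (2 * pi * real (j + 1) * x)) / 2" .
      then have "h x * (cos (2 * pi * real j * x) * cos (2 * pi * x)) * cos (2 * pi * x) ^ k
         = h x * ((cos (2 * pi * real (if j = 0 then 1 else j - 1) * x) + cos (2 * pi * real (j + 1) * x)) / 2) * cos (2 * pi * x) ^ k"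
        by (simp only:)
      then show ?thesis by (simp only: power_Suc) (simp only: algebra_simps add_divide_distrib times_divide_eq_right)
    qed
    have "integral ?I (\<lambda>x. h x * cos (2 * pi * real j * x) * cos (2 * pi * x) ^ Suc k)
       = (integral ?I (\<lambda>x. h x * cos (2 * pi * real (j + 1) * x) * cos (2 * pi * x) ^ k)
         + integral ?I (\<lambda>x. h x * cos (2 * pi * real (if j = 0 then 1 else j - 1) * x) * cos (2 * pi * x) ^ k)) / 2"
      unfolding * integral_divide
      by (subst integral_add) (intro integrable_continuous_real contk refl)+
    then show ?case unfolding Suc.IH by simp
  qed
  have mom': "integral ?I (\<lambda>x. h x * cos (2 * pi * x) ^ k) = 0" for k using mom[of 0 k] by simp
  have bdd: "compact (h ` ?I)" using cont by (intro compact_continuous_image) auto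
  then obtain B where B: "B > 0" "\<And>x. x \<in> ?I \<Longrightarrow> \<bar>h x\<bar> \<le> B"
    by (metis bounded_pos compact_imp_bounded imageI real_norm_def)
  \<comment> \<open>The function h written in the variable u = cos (2 pi x).\<close>
  define H where "H = (\<lambda>u. h (arccos u / (2 * pi)))"
  have contH: "continuous_on {-1..1} H"
    unfolding H_def
    by (rule continuous_on_compose2[OF cont])
       (auto intro!: continuous_intros arccos_lbound simp: field_simps arccos_ubound)
  have Hcos: "H (cos (2 * pi * x)) = h x" if "x \<in> ?I" for x
    using that by (simp add: H_def arccos_cos)
  have conth2: "continuous_on ?I (\<lambda>x. h x * h x)" using cont by (intro continuous_intros)
  \<comment> \<open>Replacing one factor h by a polynomial in cos (2 pi x) costs at most B * e / B
    pointwise, and h integrates to zero against that polynomial.\<close>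
  have "integral ?I (\<lambda>x. h x * h x) \<le> e" if e: "e > 0" for e
  proof -
    obtain p where p: "real_polynomial_function p" "\<And>u. u \<in> {-1..1} \<Longrightarrow> \<bar>H u - p u\<bar> < e / B"
      by (rule Stone_Weierstrass_real_polynomial_function[of "{-1..1}" H "e / B"])
         (use contH e B in auto)
    obtain a n where an: "p = (\<lambda>u. \<Sum>i\<le>n. a i * u ^ i)"
      using p(1) unfolding real_polynomial_function_iff_sum by blast
    have ci: "continuous_on ?I (\<lambda>x. h x * cos (2 * pi * x) ^ i)" for i
      using contk[of 0 i] by simp
    have ci': "(\<lambda>x. a i * (h x * cos (2 * pi * x) ^ i)) integrable_on ?I" for i
      by (intro integrable_continuous_real continuous_intros ci)
    have "integral ?I (\<lambda>x. h x * p (cos (2 * pi * x)))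
        = integral ?I (\<lambda>x. \<Sum>i\<le>n. a i * (h x * cos (2 * pi * x) ^ i))"
      by (simp add: an sum_distrib_left mult_ac)
    also have "\<dots> = (\<Sum>i\<le>n. a i * integral ?I (\<lambda>x. h x * cos (2 * pi * x) ^ i))"
      using ci' by (subst integral_sum) auto
    finally have z: "integral ?I (\<lambda>x. h x * p (cos (2 * pi * x))) = 0" by (simp add: mom')
    have contp: "continuous_on ?I (\<lambda>x. h x * p (cos (2 * pi * x)))"
      unfolding an using cont by (intro continuous_intros)
    have "integral ?I (\<lambda>x. h x * h x) = integral ?I (\<lambda>x. h x * h x - h x * p (cos (2 * pi * x)))"
      using z by (subst integral_diff) (auto intro: integrable_continuous_real conth2 contp)
    also have "\<dots> \<le> integral ?I (\<lambda>x. e)"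
    proof (rule integral_le)
      show "(\<lambda>x. h x * h x - h x * p (cos (2 * pi * x))) integrable_on ?I"
        by (intro integrable_continuous_real continuous_on_diff conth2 contp)
      fix x assume x: "x \<in> ?I"
      have "h x * h x - h x * p (cos (2 * pi * x)) = h x * (H (cos (2 * pi * x)) - p (cos (2 * pi * x)))"
        using Hcos[OF x] by (simp add: algebra_simps)
      also have "\<dots> \<le> \<bar>h x\<bar> * \<bar>H (cos (2 * pi * x)) - p (cos (2 * pi * x))\<bar>"
        by (metis abs_ge_self abs_mult)
      also have "\<dots> \<le> B * (e / B)"
        using B(1) B(2)[OF x] p(2)[of "cos (2 * pi * x)"] by (intro mult_mono) auto
      finally show "h x * h x - h x * p (cos (2 * pi * x)) \<le> e" using B by simp
    qed (rule integrable_const_ivl)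
    also have "\<dots> \<le> e" using e by simp
    finally show ?thesis .
  qed
  then have "integral ?I (\<lambda>x. h x * h x) \<le> 0" by (rule field_le_epsilon) simp
  moreover have "integral ?I (\<lambda>x. h x * h x) \<ge> 0"
    by (intro integral_nonneg integrable_continuous_real conth2) auto
  ultimately have "integral ?I (\<lambda>x. h x * h x) = 0" by simp
  then show ?thesis using integral_eq_0_iff[OF conth2] x by auto
qed


lemma integral_cos_multiple:
  fixes m :: int
  assumes "m \<noteq> 0"
  shows "integral {0..1/2} (\<lambda>x. cos (2 * pi * of_int m * x)) = 0"
proof -
  have "((\<lambda>x. cos (2 * pi * of_int m * x)) has_integral
      (sin (2 * pi * of_int m * (1/2)) / (2 * pi * of_int m) - sin (2 * pi * of_int m * 0) / (2 * pi * of_int m))) {0..1/2}"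
    using assms
    by (intro fundamental_theorem_of_calculus)
       (auto intro!: derivative_eq_intros simp flip: has_real_derivative_iff_has_vector_derivative)
  also have "sin (2 * pi * of_int m * (1/2)) = 0"
    by (simp add: sin_zero_iff_int2)
  finally show ?thesis by (simp add: integral_unique)
qed

lemma integral_cos_mult_cos:
  "integral {0..1/2} (\<lambda>x. cos (2 * pi * real j * x) * cos (2 * pi * real (Suc k) * x)) = (if j = Suc k then 1/4 else 0)"
proof -
  define m1 m2 :: int where "m1 = int j - int (Suc k)" and "m2 = int j + int (Suc k)"
  have eq: "cos (2 * pi * real j * x) * cos (2 * pi * real (Suc k) * x)
     = (cos (2 * pi * of_int m1 * x) + cos (2 * pi * of_int m2 * x)) / 2" for x
    unfolding cos_times_cos m1_def m2_def by (simp add: algebra_simps)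
  have "integral {0..1/2} (\<lambda>x. cos (2 * pi * real j * x) * cos (2 * pi * real (Suc k) * x))
     = (integral {0..1/2} (\<lambda>x. cos (2 * pi * of_int m1 * x)) + integral {0..1/2} (\<lambda>x. cos (2 * pi * of_int m2 * x))) / 2"
    unfolding eq integral_divide
    by (subst integral_add) (intro integrable_continuous_real continuous_intros refl)+
  also have "integral {0..1/2} (\<lambda>x. cos (2 * pi * of_int m2 * x)) = 0"
    by (rule integral_cos_multiple) (simp add: m2_def)
  also have "integral {0..1/2} (\<lambda>x. cos (2 * pi * of_int m1 * x)) = (if j = Suc k then 1/2 else 0)"
    using integral_cos_multiple[of m1] by (auto simp: m1_def)
  finally show ?thesis by auto
qed

section \<open>Theta series and Poisson summation\<close>

text \<open>From n <= n^2 <= y^2: a geometric majorant for Gaussian terms, used in the M-tests for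
  the theta series.\<close>

lemma exp_square_le_power:
  fixes t y :: real
  assumes "t > 0" "y \<ge> real n"
  shows "exp (- pi * t * y\<^sup>2) \<le> exp (- pi * t) ^ n"
proof -
  have "real n \<le> (real n)\<^sup>2" by (cases n) (auto simp: power2_eq_square)
  also have "\<dots> \<le> y\<^sup>2" using assms by (intro power_mono) auto
  finally have "pi * t * real n \<le> pi * t * y\<^sup>2" using assms by (intro mult_left_mono) auto
  then have "- pi * t * y\<^sup>2 \<le> real n * (- pi * t)" by (simp add: mult_ac)
  then have "exp (- pi * t * y\<^sup>2) \<le> exp (real n * (- pi * t))" by simp
  then show ?thesis by (simp only: exp_of_nat_mult)
qed

lemma summable_exp_power: "t > 0 \<Longrightarrow> summable (\<lambda>n. exp (- pi * t) ^ n)" for t :: real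
  by (intro summable_geometric) simp

text \<open>This is (theta(t) - 1) / 2 for Jacobi's theta function. Without the constant term it
  decays exponentially, so its integral over [1, \<infinity>) against any power of t
  converges.\<close>

definition half_theta :: "real \<Rightarrow> real" where
  "half_theta t = (\<Sum>n. exp (- pi * t * (real (Suc n))\<^sup>2))"

lemma summable_half_theta:
  assumes "t > 0"
  shows "summable (\<lambda>n. exp (- pi * t * (real (Suc n))\<^sup>2))"
  by (rule summable_comparison_test[OF _ summable_exp_power[OF assms]])
     (use exp_square_le_power[OF assms] in \<open>auto intro!: exI[of _ 0]\<close>)

text \<open>The left side is the sum of exp(-pi t (m + x)^2) over all integers m, with m = n and m =
  -(n + 1) paired; the right side is its Fourier series with opposite frequencies paired. The cosine
  coefficients of both sides on [0, 1/2] are compared.\<close>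

lemma poisson_gaussian:
  fixes t x :: real
  assumes t: "t > 0" and x: "x \<in> {0..1/2}"
  shows "(\<Sum>n. exp (- pi * t * (real n + x)\<^sup>2) + exp (- pi * t * (real n + 1 - x)\<^sup>2))
       = 1 / sqrt t + (\<Sum>n. 2 / sqrt t * exp (- pi * (1 / t) * (real (Suc n))\<^sup>2) * cos (2 * pi * real (Suc n) * x))"
proof -
  let ?I = "{0..1/2::real}"
  define f where "f = (\<lambda>n x. exp (- pi * t * (real n + x)\<^sup>2) + exp (- pi * t * (real n + 1 - x)\<^sup>2))"
  define g where "g = (\<lambda>n x. 2 / sqrt t * exp (- pi * (1 / t) * (real (Suc n))\<^sup>2) * cos (2 * pi * real (Suc n) * x))"
  define F where "F = (\<lambda>x. \<Sum>n. f n x)"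
  define G where "G = (\<lambda>x. \<Sum>n. g n x)"
  have f_le: "norm (f n x) \<le> 2 * exp (- pi * t) ^ n" if "x \<in> ?I" for n x
    using exp_square_le_power[OF t, of n "real n + x"] exp_square_le_power[OF t, of n "real n + 1 - x"] that
    unfolding f_def by auto
  have g_le: "norm (g n x) \<le> 2 / sqrt t * exp (- pi * (1 / t)) ^ n" for n x
  proof -
    have "norm (g n x) \<le> (2 / sqrt t * exp (- pi * (1 / t) * (real (Suc n))\<^sup>2)) * 1"
      unfolding g_def norm_mult using t by (intro mult_mono) auto
    also have "\<dots> \<le> 2 / sqrt t * exp (- pi * (1 / t)) ^ n"
      unfolding mult_1_right using t by (intro mult_left_mono exp_square_le_power) auto
    finally show ?thesis .
  qed
  have f_cont: "continuous_on ?I (f n)" for n unfolding f_def by (intro continuous_intros)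
  have g_cont: "continuous_on ?I (g n)" for n unfolding g_def by (intro continuous_intros)
  have sf: "summable (\<lambda>n. 2 * exp (- pi * t) ^ n)" by (intro summable_mult summable_exp_power t)
  have sg: "summable (\<lambda>n. 2 / sqrt t * exp (- pi * (1 / t)) ^ n)"
    using t by (intro summable_mult summable_exp_power) auto
  have F_cont: "continuous_on ?I F" unfolding F_def by (rule integral_sums_M_test(1)[OF f_cont f_le sf])
  have G_cont: "continuous_on ?I G" unfolding G_def by (rule integral_sums_M_test(1)[OF g_cont g_le sg])
  have F_coeff: "integral ?I (\<lambda>x. F x * cos (2 * pi * real k * x)) = exp (- pi * (real k)\<^sup>2 / t) / (2 * sqrt t)" for k
  proof -
    let ?c = "\<lambda>x. cos (2 * pi * real k * x)"
    let ?p = "\<lambda>u. exp (- pi * t * u\<^sup>2) * ?c u"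
    have p_int: "?p integrable_on {a..b}" for a b
      by (intro integrable_continuous_real continuous_intros)
    have c1: "?c (x + real n) = ?c x" for n x
      using cos.plus_of_nat[of "2 * pi * real k * x" "k * n"] by (simp add: algebra_simps)
    \<comment> \<open>The shift by n covers [n, n + 1/2] and the reflected shift covers
      [n + 1/2, n + 1]; the cosine is unchanged by both. Summed over n, the pieces fill the half
      line.\<close>
    have piece: "integral ?I (\<lambda>x. f n x * ?c x) = integral {real n..real (Suc n)} ?p" for n
    proof -
      have "integral ?I (\<lambda>x. f n x * ?c x)
          = integral ?I (\<lambda>x. exp (- pi * t * (real n + x)\<^sup>2) * ?c x) + integral ?I (\<lambda>x. exp (- pi * t * (real n + 1 - x)\<^sup>2) * ?c x)"
        unfolding f_def distrib_right
        by (subst integral_add) (intro integrable_continuous_real continuous_intros refl)+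
      also have "integral ?I (\<lambda>x. exp (- pi * t * (real n + x)\<^sup>2) * ?c x) = integral ?I (?p \<circ> (\<lambda>x. x + real n))"
        by (simp only: o_def c1 add.commute)
      also have "\<dots> = integral {real n..real n + 1/2} ?p"
        by (subst integral_shift) (auto intro!: continuous_intros simp: add.commute)
      also have "integral ?I (\<lambda>x. exp (- pi * t * (real n + 1 - x)\<^sup>2) * ?c x)
          = integral {-(1/2)..-0} (\<lambda>x. exp (- pi * t * (real n + 1 + x)\<^sup>2) * ?c x)"
        using Henstock_Kurzweil_Integration.integral_reflect_real[of "1/2" 0 "\<lambda>x. exp (- pi * t * (real n + 1 - x)\<^sup>2) * ?c x"]
        by simp
      also have "\<dots> = integral {-(1/2)..-0} (?p \<circ> (\<lambda>x. x + real (Suc n)))"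
        unfolding o_def c1 by (simp add: add_ac)
      also have "\<dots> = integral {real n + 1/2..real (Suc n)} ?p"
        by (subst integral_shift) (auto intro!: continuous_intros simp: add.commute)
      also have "integral {real n..real n + 1/2} ?p + integral {real n + 1/2..real (Suc n)} ?p = integral {real n..real (Suc n)} ?p"
        by (rule Henstock_Kurzweil_Integration.integral_combine[OF _ _ p_int]) auto
      finally show ?thesis .
    qed
    have "(\<Sum>n<N. integral ?I (\<lambda>x. f n x * ?c x)) = integral {0..real N} ?p" for N
    proof (induction N)
      case (Suc N)
      have "integral {0..real N} ?p + integral {real N..real (Suc N)} ?p = integral {0..real (Suc N)} ?p"
        by (rule Henstock_Kurzweil_Integration.integral_combine[OF _ _ p_int]) auto
      then show ?case using Suc.IH piece[of N] by (simp only: sum.lessThan_Suc)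
    qed simp
    then have "(\<lambda>n. integral ?I (\<lambda>x. f n x * ?c x)) sums (exp (- pi * (real k)\<^sup>2 / t) / (2 * sqrt t))"
      unfolding sums_def using integral_gaussian_cos_tendsto[OF t, of "real k"] by simp
    moreover have "(\<lambda>n. integral ?I (\<lambda>x. f n x * ?c x)) sums integral ?I (\<lambda>x. \<Sum>n. f n x * ?c x)"
    proof (rule integral_sums_M_test(2)[OF _ _ sf])
      show "continuous_on ?I (\<lambda>x. f n x * ?c x)" for n using f_cont by (intro continuous_intros)
      show "norm (f n x * ?c x) \<le> 2 * exp (- pi * t) ^ n" if "x \<in> ?I" for n x
        unfolding norm_mult using mult_mono[OF f_le[OF that] abs_cos_le_one] by simp
    qed
    moreover have "(\<Sum>n. f n x * ?c x) = F x * ?c x" if "x \<in> ?I" for x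
      unfolding F_def
      by (rule suminf_mult2[symmetric], rule summable_comparison_test[OF _ sf]) (use f_le[OF that] in blast)
    ultimately show ?thesis by (metis (no_types, lifting) Henstock_Kurzweil_Integration.integral_cong sums_unique2)
  qed
  have G_coeff: "integral ?I (\<lambda>x. G x * cos (2 * pi * real k * x)) =
      (if k = 0 then 0 else exp (- pi * (real k)\<^sup>2 / t) / (2 * sqrt t))" for k
  proof -
    let ?c = "\<lambda>x. cos (2 * pi * real k * x)"
    have "integral ?I (\<lambda>x. g n x * ?c x) = (if k = Suc n then exp (- pi * (real k)\<^sup>2 / t) / (2 * sqrt t) else 0)" for n
    proof -
      have "integral ?I (\<lambda>x. g n x * ?c x) = integral ?I (\<lambda>x. 2 / sqrt t * exp (- pi * (1 / t) * (real (Suc n))\<^sup>2) * (?c x * cos (2 * pi * real (Suc n) * x)))"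
        by (simp only: g_def mult_ac)
      also have "\<dots> = 2 / sqrt t * exp (- pi * (1 / t) * (real (Suc n))\<^sup>2) * (if k = Suc n then 1/4 else 0)"
        by (simp only: integral_mult_right integral_cos_mult_cos)
      finally show ?thesis by auto
    qed
    \<comment> \<open>Truncated subtraction sends k = 0 and k = 1 both to position 0. For k = 0 the
      entry placed there is 0, so one formula covers every k.\<close>
    then have "(\<lambda>n. integral ?I (\<lambda>x. g n x * ?c x)) = (\<lambda>n. if n = k - 1 then (if k = 0 then 0 else exp (- pi * (real k)\<^sup>2 / t) / (2 * sqrt t)) else 0)"
      by auto
    then have "(\<lambda>n. integral ?I (\<lambda>x. g n x * ?c x)) sums (if k = 0 then 0 else exp (- pi * (real k)\<^sup>2 / t) / (2 * sqrt t))"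
      using sums_single[of "k - 1" "\<lambda>_. if k = 0 then 0 else exp (- pi * (real k)\<^sup>2 / t) / (2 * sqrt t)"]
      by (simp only:)
    moreover have "(\<lambda>n. integral ?I (\<lambda>x. g n x * ?c x)) sums integral ?I (\<lambda>x. \<Sum>n. g n x * ?c x)"
    proof (rule integral_sums_M_test(2)[OF _ _ sg])
      show "continuous_on ?I (\<lambda>x. g n x * ?c x)" for n using g_cont by (intro continuous_intros)
      show "norm (g n x * ?c x) \<le> 2 / sqrt t * exp (- pi * (1 / t)) ^ n" for n x
        unfolding norm_mult using mult_mono[OF g_le abs_cos_le_one] t by simp
    qed
    moreover have "(\<Sum>n. g n x * ?c x) = G x * ?c x" for x
      unfolding G_def
      by (rule suminf_mult2[symmetric], rule summable_comparison_test[OF _ sg]) (use g_le in blast)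
    ultimately show ?thesis by (simp add: sums_iff)
  qed
  have "F x - (1 / sqrt t + G x) = 0"
  proof (rule cos_coeffs_zero_imp_zero[OF _ _ x])
    show "continuous_on ?I (\<lambda>x. F x - (1 / sqrt t + G x))"
      by (intro continuous_intros F_cont G_cont)
    fix k
    let ?c = "\<lambda>x. cos (2 * pi * real k * x)"
    have i: "(\<lambda>x. F x * ?c x) integrable_on ?I" "(\<lambda>x. G x * ?c x) integrable_on ?I" "(\<lambda>x. 1 / sqrt t * ?c x) integrable_on ?I"
      by (intro integrable_continuous_real continuous_intros F_cont G_cont)+
    have c0: "integral ?I ?c = (if k = 0 then 1/2 else 0)"
      using integral_cos_multiple[of "int k"] by auto
    have "integral ?I (\<lambda>x. (F x - (1 / sqrt t + G x)) * ?c x)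
        = integral ?I (\<lambda>x. F x * ?c x - (1 / sqrt t * ?c x + G x * ?c x))"
      by (simp only: algebra_simps)
    also have "\<dots> = integral ?I (\<lambda>x. F x * ?c x) - (integral ?I (\<lambda>x. 1 / sqrt t * ?c x) + integral ?I (\<lambda>x. G x * ?c x))"
      using i by (simp only: integral_diff integral_add integrable_add)
    also have "\<dots> = 0"
      unfolding F_coeff G_coeff integral_mult_right c0 by auto
    finally show "integral ?I (\<lambda>x. (F x - (1 / sqrt t + G x)) * ?c x) = 0" .
  qed
  then show ?thesis by (simp add: F_def G_def f_def g_def)
qed

text \<open>Poisson summation at x = 0, with theta = 1 + 2 \<open>half_theta\<close>.\<close>

lemma half_theta_inverse:
  assumes t: "t > 0"
  shows "1 + 2 * half_theta (1 / t) = sqrt t * (1 + 2 * half_theta t)"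
proof -
  let ?e = "\<lambda>n. exp (- pi * t * (real n)\<^sup>2)"
  have s1: "(\<lambda>n. ?e (Suc n)) sums half_theta t"
    unfolding half_theta_def using summable_half_theta[OF t] by (rule summable_sums)
  then have s0: "?e sums (half_theta t + 1)" using sums_Suc_iff[of ?e "half_theta t"] by simp
  have "(\<lambda>n. exp (- pi * t * (real n + 0)\<^sup>2) + exp (- pi * t * (real n + 1 - 0)\<^sup>2)) sums (half_theta t + 1 + half_theta t)"
    using sums_add[OF s0 s1] by (simp add: add_ac)
  moreover have "(\<lambda>n. 2 / sqrt t * exp (- pi * (1 / t) * (real (Suc n))\<^sup>2) * cos (2 * pi * real (Suc n) * 0)) sums (2 / sqrt t * half_theta (1 / t))"
    unfolding half_theta_def mult_zero_right cos_zero mult_1_right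
    using t by (intro sums_mult summable_sums summable_half_theta) auto
  ultimately have "half_theta t + 1 + half_theta t = 1 / sqrt t + 2 / sqrt t * half_theta (1 / t)"
    using poisson_gaussian[OF t, of 0] by (simp only: sums_iff) auto
  then show ?thesis using t by (simp add: field_simps)
qed

section \<open>The Mellin transform of the theta function\<close>

lemma continuous_on_half_theta:
  assumes "a > 0"
  shows "continuous_on {a..b} half_theta"
  unfolding half_theta_def
proof (rule integral_sums_M_test(1)[OF _ _ summable_exp_power[OF assms]])
  show "continuous_on {a..b} (\<lambda>t. exp (- pi * t * (real (Suc n))\<^sup>2))" for n
    by (intro continuous_intros)
  fix n t assume t: "t \<in> {a..b}"
  have "exp (- pi * t * (real (Suc n))\<^sup>2) \<le> exp (- pi * a * (real (Suc n))\<^sup>2)"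
    using t by (simp del: of_nat_Suc)
  also have "\<dots> \<le> exp (- pi * a) ^ n" using assms by (intro exp_square_le_power) auto
  finally show "norm (exp (- pi * t * (real (Suc n))\<^sup>2)) \<le> exp (- pi * a) ^ n" by simp
qed

lemma half_theta_nonneg: "t > 0 \<Longrightarrow> half_theta t \<ge> 0"
  unfolding half_theta_def by (intro suminf_nonneg summable_half_theta) auto

text \<open>For t >= 1 the ratio exp(-pi t) is at most 1/2, so the geometric majorant is at most
  twice its first term.\<close>

lemma half_theta_le:
  assumes t: "t \<ge> 1"
  shows "half_theta t \<le> 2 * exp (- pi * t)"
proof -
  define r where "r = exp (- pi * t)"
  have "r \<le> exp (- 1)"
    unfolding r_def using t pi_gt3 mult_mono[of 1 pi 1 t] by auto
  also have "exp (- 1 :: real) \<le> 1/2"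
    using exp_ge_add_one_self[of 1] by (simp add: exp_minus field_simps)
  finally have r: "r \<le> 1/2" "r > 0" by (auto simp: r_def)
  have "half_theta t \<le> (\<Sum>n. r ^ Suc n)"
    unfolding half_theta_def
  proof (rule suminf_le)
    show "exp (- pi * t * (real (Suc n))\<^sup>2) \<le> r ^ Suc n" for n
      unfolding r_def using t by (intro exp_square_le_power) auto
    show "summable (\<lambda>n. exp (- pi * t * (real (Suc n))\<^sup>2))" using t by (intro summable_half_theta) auto
    show "summable (\<lambda>n. r ^ Suc n)" using r by (subst summable_Suc_iff) (auto intro: summable_geometric)
  qed
  also have "(\<Sum>n. r ^ Suc n) = r * (1 / (1 - r))"
    using r suminf_mult[of "\<lambda>n. r ^ n" r] suminf_geometric[of r] summable_geometric[of r] by simp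
  also have "\<dots> \<le> r * 2" using r by (intro mult_left_mono) (auto simp: field_simps)
  finally show ?thesis by (simp add: r_def)
qed

section \<open>Riemann's symmetric integral as an entire function\<close>

text \<open>Riemann's integrand \<open>half_theta t\<close> * (t^(s/2 - 1) + t^(-(s + 1)/2)), whose
  two exponents are exchanged by s -> 1 - s. Powers are written through \<open>exp\<close> so that
  the dependence on s is visibly entire.\<close>

definition theta_kernel :: "complex \<Rightarrow> real \<Rightarrow> complex" where
  "theta_kernel s t = of_real (half_theta t) *
     (exp ((s / 2 - 1) * of_real (ln t)) + exp (- (s + 1) / 2 * of_real (ln t)))"

text \<open>The integral over [1, \<infinity>), cut into unit intervals so that holomorphy follows
  from locally uniform convergence of a series.\<close>

definition theta_integral :: "complex \<Rightarrow> complex" where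
  "theta_integral s = (\<Sum>k. integral {real k + 1..real k + 2} (theta_kernel s))"

lemma theta_kernel_symmetric: "theta_kernel (1 - s) = theta_kernel s"
proof -
  have "(1 - s) / 2 - 1 = - (s + 1) / 2" "- (1 - s + 1) / 2 = s / 2 - 1" by (simp_all add: field_simps)
  then show ?thesis by (simp only: theta_kernel_def add.commute fun_eq_iff simp_thms)
qed

lemma theta_integral_symmetric: "theta_integral (1 - s) = theta_integral s"
  by (simp add: theta_integral_def theta_kernel_symmetric)

lemma continuous_on_theta_kernel:
  assumes "a > 0"
  shows "continuous_on {a..b} (theta_kernel s)"
  unfolding theta_kernel_def
  using assms by (intro continuous_intros continuous_on_half_theta) auto

lemma holomorphic_theta_kernel_integral:
  assumes "a > 0"
  shows "(\<lambda>s. integral {a..b} (theta_kernel s)) holomorphic_on UNIV"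
proof -
  define fx where "fx = (\<lambda>(s::complex) (t::real). of_real (half_theta t) *
     (of_real (ln t) / 2 * exp ((s / 2 - 1) * of_real (ln t)) - of_real (ln t) / 2 * exp (- (s + 1) / 2 * of_real (ln t))))"
  have "(\<lambda>s. integral (cbox a b) (theta_kernel s)) holomorphic_on UNIV"
  proof (rule leibniz_rule_holomorphic[where fx = fx])
    show "((\<lambda>s. theta_kernel s t) has_field_derivative fx s t) (at s within UNIV)" for s t
      unfolding theta_kernel_def fx_def
      by (rule derivative_eq_intros refl | simp add: field_simps)+
    show "theta_kernel s integrable_on cbox a b" for s
      using continuous_on_theta_kernel[OF assms] by (intro integrable_continuous) auto
    have 1: "continuous_on (UNIV \<times> cbox a b) (\<lambda>p. half_theta (snd p))"
      by (rule continuous_on_compose2[OF continuous_on_half_theta[OF assms, of b]])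
         (auto intro!: continuous_intros)
    have 2: "continuous_on (UNIV \<times> cbox a b) (\<lambda>p. ln (snd p))"
      using assms by (auto intro!: continuous_intros)
    show "continuous_on (UNIV \<times> cbox a b) (\<lambda>(s, t). fx s t)"
      unfolding fx_def case_prod_unfold by (intro continuous_intros 1 2) auto
  qed simp
  then show ?thesis by simp
qed

lemma norm_theta_kernel_integral_le:
  assumes B: "B \<ge> 0" "Re s / 2 - 1 \<le> B" "- (Re s + 1) / 2 \<le> B"
  shows "norm (integral {real k + 1..real k + 2} (theta_kernel s)) \<le> 4 * exp (- pi * (real k + 1)) * (real k + 2) powr B"
proof -
  have "norm (integral {real k + 1..real k + 2} (theta_kernel s))
      \<le> 4 * exp (- pi * (real k + 1)) * (real k + 2) powr B * ((real k + 2) - (real k + 1))"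
  proof (rule integral_bound)
    show "continuous_on {real k + 1..real k + 2} (theta_kernel s)" by (intro continuous_on_theta_kernel) auto
    fix t assume "t \<in> {real k + 1..real k + 2}"
    then have t: "t \<ge> 1" "real k + 1 \<le> t" "t \<le> real k + 2" by auto
    have e: "norm (exp (w * of_real (ln t))) \<le> (real k + 2) powr B" if "Re w \<le> B" for w :: complex
    proof -
      have "norm (exp (w * of_real (ln t))) = t powr Re w" using t by (simp add: powr_def)
      also have "\<dots> \<le> t powr B" using t that by (intro powr_mono) auto
      also have "\<dots> \<le> (real k + 2) powr B" using t B by (intro powr_mono2) auto
      finally show ?thesis .
    qed
    have "norm (theta_kernel s t) \<le> (2 * exp (- pi * (real k + 1))) * ((real k + 2) powr B + (real k + 2) powr B)"
      unfolding theta_kernel_def norm_mult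
    proof (intro mult_mono)
      have "half_theta t \<le> 2 * exp (- pi * t)" using t by (intro half_theta_le) auto
      also have "\<dots> \<le> 2 * exp (- pi * (real k + 1))" using t by simp
      finally show "norm (of_real (half_theta t) :: complex) \<le> 2 * exp (- pi * (real k + 1))"
        using half_theta_nonneg[of t] t by simp
      show "norm (exp ((s / 2 - 1) * of_real (ln t)) + exp (- (s + 1) / 2 * of_real (ln t)))
          \<le> (real k + 2) powr B + (real k + 2) powr B"
        using B by (intro order_trans[OF norm_triangle_ineq] add_mono e) auto
    qed auto
    then show "norm (theta_kernel s t) \<le> 4 * exp (- pi * (real k + 1)) * (real k + 2) powr B" by simp
  qed auto
  then show ?thesis by simp
qed

lemma theta_integral_holomorphic_sums:
  "theta_integral holomorphic_on UNIV"
  "(\<lambda>k. integral {real k + 1..real k + 2} (theta_kernel s)) sums theta_integral s"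
proof -
  let ?f = "\<lambda>k s. integral {real k + 1..real k + 2} (theta_kernel s)"
  obtain g where g: "\<And>s. (\<lambda>k. ?f k s) sums g s" "\<And>s. g field_differentiable (at s)"
  proof (rule series_differentiable_comparison_complex[OF open_UNIV, of ?f])
    fix n :: nat and x :: complex
    show "?f n field_differentiable (at x)"
      using holomorphic_theta_kernel_integral[of "real n + 1" "real n + 2"]
      by (simp add: holomorphic_on_def)
  next
    fix x :: complex
    \<comment> \<open>Bounds |Re y| on the unit ball around x, hence both exponents of the kernel;
      the exponential decay then beats k^B uniformly on that ball.\<close>
    define B where "B = norm x + 1"
    have "\<forall>\<^sub>F k in sequentially. 4 * exp (- pi * (real k + 1)) * (real k + 2) powr B \<le> real (Suc k) powr (- 2)"
      by real_asymp
    then have "\<forall>\<^sub>F k in sequentially. \<forall>y\<in>ball x 1 \<inter> UNIV. norm (?f k y) \<le> norm (of_real (real (Suc k) powr (- 2)) :: complex)"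
    proof eventually_elim
      case (elim k)
      have "norm (?f k y) \<le> real (Suc k) powr (- 2)" if "y \<in> ball x 1" for y
      proof -
        have "norm y \<le> B" using that norm_triangle_ineq2[of y x] by (simp add: B_def dist_norm norm_minus_commute)
        then have "\<bar>Re y\<bar> \<le> B" using abs_Re_le_cmod[of y] by linarith
        then have "norm (?f k y) \<le> 4 * exp (- pi * (real k + 1)) * (real k + 2) powr B"
          by (intro norm_theta_kernel_integral_le) (auto simp: B_def abs_le_iff)
        then show ?thesis using elim by linarith
      qed
      then show ?case by simp
    qed
    moreover have "summable (\<lambda>k. of_real (real (Suc k) powr (- 2)) :: complex)"
      unfolding summable_of_real_iff by (intro summable_Suc_powr) auto
    ultimately show "\<exists>d h. 0 < d \<and> summable h \<and> range h \<subseteq> \<real>\<^sub>\<ge>\<^sub>0 \<and>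
             (\<forall>\<^sub>F n in sequentially. \<forall>y\<in>ball x d \<inter> UNIV. cmod (?f n y) \<le> cmod (h n))"
      by (intro exI[of _ 1] exI[of _ "\<lambda>k. of_real (real (Suc k) powr (- 2)) :: complex"]) auto
  qed blast
  have eq: "theta_integral = g"
    using g(1) by (auto simp: fun_eq_iff theta_integral_def sums_iff)
  show "theta_integral holomorphic_on UNIV" unfolding eq using g(2) by (simp add: holomorphic_on_def)
  show "(\<lambda>k. ?f k s) sums theta_integral s" unfolding eq by (rule g)
qed

section \<open>Mellin transform for real arguments\<close>

definition real_theta_kernel :: "real \<Rightarrow> real \<Rightarrow> real" where
  "real_theta_kernel \<sigma> t = half_theta t * (t powr (\<sigma> / 2 - 1) + t powr (- (\<sigma> + 1) / 2))"

lemma continuous_on_real_theta_kernel: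
  assumes "a > 0"
  shows "continuous_on {a..b} (real_theta_kernel \<sigma>)"
  unfolding real_theta_kernel_def
  using assms by (intro continuous_intros continuous_on_half_theta) auto

lemma integral_real_theta_kernel_tendsto:
  "(\<lambda>n. of_real (integral {1..real (Suc n)} (real_theta_kernel \<sigma>))) \<longlonglongrightarrow> theta_integral (of_real \<sigma>)"
proof -
  let ?I = "\<lambda>a b. integral {a..b} (real_theta_kernel \<sigma>)"
  have int: "real_theta_kernel \<sigma> integrable_on {a..b}" if "a > 0" for a b
    using that by (intro integrable_continuous_real continuous_on_real_theta_kernel)
  have piece: "integral {real k + 1..real k + 2} (theta_kernel (of_real \<sigma>)) = of_real (?I (real k + 1) (real k + 2))" for k
  proof -
    have "((\<lambda>t. complex_of_real (real_theta_kernel \<sigma> t)) has_integral of_real (?I (real k + 1) (real k + 2))) {real k + 1..real k + 2}"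
      by (intro has_integral_of_real integrable_integral int) auto
    then have "integral {real k + 1..real k + 2} (\<lambda>t. complex_of_real (real_theta_kernel \<sigma> t)) = of_real (?I (real k + 1) (real k + 2))"
      by (rule integral_unique)
    moreover have "theta_kernel (of_real \<sigma>) t = of_real (real_theta_kernel \<sigma> t)" if "t \<in> {real k + 1..real k + 2}" for t
    proof -
      have "t > 0" using that by auto
      then have "t powr (\<sigma> / 2 - 1) = exp ((\<sigma> / 2 - 1) * ln t)" "t powr (- (\<sigma> + 1) / 2) = exp (- (\<sigma> + 1) / 2 * ln t)"
        by (simp_all add: powr_def)
      then show ?thesis unfolding theta_kernel_def real_theta_kernel_def by (simp add: exp_of_real[symmetric])
    qed
    ultimately show ?thesis by (metis (no_types, lifting) Henstock_Kurzweil_Integration.integral_cong)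
  qed
  have "(\<Sum>k<n. ?I (real k + 1) (real k + 2)) = ?I 1 (real (Suc n))" for n
  proof (induction n)
    case (Suc n)
    have "?I 1 (real n + 1) + ?I (real n + 1) (real n + 2) = ?I 1 (real n + 2)"
      by (rule Henstock_Kurzweil_Integration.integral_combine) (auto intro: int)
    then show ?case using Suc by (simp add: add_ac)
  qed simp
  then have "(\<Sum>k<n. integral {real k + 1..real k + 2} (theta_kernel (of_real \<sigma>))) = of_real (?I 1 (real (Suc n)))" for n
    unfolding piece by (simp flip: of_real_sum)
  then show ?thesis using theta_integral_holomorphic_sums(2)[of "of_real \<sigma>"] by (simp add: sums_def)
qed

text \<open>The truncation avoids 0, where the theta series is not uniformly convergent, and is
  symmetric under t -> 1/t, which the folding of the integral relies on. The bound independent of n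
  is the domination for Tannery's theorem.\<close>

lemma Gamma_integral_truncated:
  fixes z c :: real
  assumes z: "z > 0" and c: "c > 0"
  defines "J \<equiv> \<lambda>n. integral {1 / real (Suc n)..real (Suc n)} (\<lambda>t. exp (- c * t) * t powr (z - 1))"
  shows "J n \<ge> 0" "J n \<le> c powr (- z) * Gamma z" "J \<longlonglongrightarrow> c powr (- z) * Gamma z"
proof -
  let ?f = "\<lambda>u. u powr (z - 1) / exp u"
  let ?S = "\<lambda>n. {c / real (Suc n)..c * real (Suc n)}"
  have f: "(?f has_integral Gamma z) {0..}" by (rule Gamma_integral_real[OF z])
  have fS: "?f integrable_on ?S n" for n
  proof -
    have "0 < c / real (Suc n)" using c by simp
    then have "u \<noteq> 0" if "u \<in> ?S n" for u using that by auto
    then show ?thesis by (intro integrable_continuous_real continuous_intros) auto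
  qed
  have SS: "?S n \<subseteq> {0..}" for n
  proof -
    have "0 \<le> c / real (Suc n)" using c by simp
    then show ?thesis by auto
  qed
  have le: "1 / real (Suc n) \<le> real (Suc n)" for n
    using mult_mono[of 1 "real (Suc n)" 1 "real (Suc n)"] by (simp add: divide_simps)
  have J: "J n = c powr (- z) * integral (?S n) ?f" for n
  proof -
    have "((\<lambda>t. c *\<^sub>R ?f (c * t)) has_integral integral {c * (1 / real (Suc n))..c * real (Suc n)} ?f) {1 / real (Suc n)..real (Suc n)}"
    proof (rule has_integral_substitution)
      show "(\<lambda>t. c * t) ` {1 / real (Suc n)..real (Suc n)} \<subseteq> {c * (1 / real (Suc n))..c * real (Suc n)}"
        using c by (auto intro!: mult_left_mono simp del: of_nat_Suc times_divide_eq_right)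
      have "0 < c * (1 / real (Suc n))" using c by simp
      then have "u \<noteq> 0" if "u \<in> {c * (1 / real (Suc n))..c * real (Suc n)}" for u using that by auto
      then show "continuous_on {c * (1 / real (Suc n))..c * real (Suc n)} ?f"
        by (intro continuous_intros) auto
      show "((\<lambda>t. c * t) has_field_derivative c) (at t within {1 / real (Suc n)..real (Suc n)})" for t
        by (auto intro!: derivative_eq_intros)
    qed (use c le[of n] in \<open>auto intro!: mult_left_mono simp del: of_nat_Suc times_divide_eq_right\<close>)
    then have "integral (?S n) ?f = integral {1 / real (Suc n)..real (Suc n)} (\<lambda>t. c *\<^sub>R ?f (c * t))"
      by (simp add: integral_unique)
    also have "\<dots> = integral {1 / real (Suc n)..real (Suc n)} (\<lambda>t. c powr z * (exp (- c * t) * t powr (z - 1)))"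
    proof (rule Henstock_Kurzweil_Integration.integral_cong)
      fix t assume t: "t \<in> {1 / real (Suc n)..real (Suc n)}"
      moreover have "0 < 1 / real (Suc n)" by simp
      ultimately have "t > 0" by (metis atLeastAtMost_iff less_le_trans)
      then have "(c * t) powr (z - 1) = c powr (z - 1) * t powr (z - 1)" using c by (simp add: powr_mult)
      moreover have "c * c powr (z - 1) = c powr z" using c by (simp add: powr_mult_base)
      ultimately show "c *\<^sub>R ?f (c * t) = c powr z * (exp (- c * t) * t powr (z - 1))"
        by (simp add: exp_minus field_simps)
    qed
    also have "\<dots> = c powr z * J n" by (simp add: J_def)
    finally show ?thesis using c by (simp add: powr_minus field_simps)
  qed
  have "integral (?S n) ?f \<ge> 0" by (intro integral_nonneg fS) auto
  then show "J n \<ge> 0" using c by (simp add: J)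
  have "integral (?S n) ?f \<le> integral {0..} ?f"
    using fS f by (intro integral_subset_le SS) (auto simp: has_integral_integrable)
  then show "J n \<le> c powr (- z) * Gamma z" using c f by (simp add: J integral_unique)
  have "(\<lambda>n. integral {0..} (\<lambda>u. if u \<in> ?S n then ?f u else 0)) \<longlonglongrightarrow> integral {0..} ?f"
  proof (rule dominated_convergence(2))
    show "(\<lambda>u. if u \<in> ?S n then ?f u else 0) integrable_on {0..}" for n
      using fS[of n] SS[of n] by (subst integrable_restrict_Int) (auto simp: Int_absorb2)
    show "?f integrable_on {0..}" using f by (rule has_integral_integrable)
    show "norm (if u \<in> ?S n then ?f u else 0) \<le> ?f u" for n u by auto
    fix u :: real assume u: "u \<in> {0..}"
    show "(\<lambda>n. if u \<in> ?S n then ?f u else 0) \<longlonglongrightarrow> ?f u"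
    proof (cases "u = 0")
      case True
      \<comment> \<open>Here \<open>0 powr (z - 1)\<close> is 0, so both branches agree at the
        endpoint.\<close>
      show ?thesis unfolding True by (simp cong: if_cong)
    next
      case False
      then have u: "u > 0" using u by simp
      have "\<forall>\<^sub>F n in sequentially. c / real (Suc n) < u" using u c by real_asymp
      moreover have "\<forall>\<^sub>F n in sequentially. u < c * real (Suc n)" using u c by real_asymp
      ultimately have "\<forall>\<^sub>F n in sequentially. (if u \<in> ?S n then ?f u else 0) = ?f u"
        by eventually_elim auto
      then show ?thesis by (rule tendsto_eventually)
    qed
  qed
  also have "(\<lambda>n. integral {0..} (\<lambda>u. if u \<in> ?S n then ?f u else 0)) = (\<lambda>n. integral (?S n) ?f)"
    unfolding Henstock_Kurzweil_Integration.integral_restrict_Int Int_absorb2[OF SS] ..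
  finally show "J \<longlonglongrightarrow> c powr (- z) * Gamma z"
    using f unfolding J by (intro tendsto_mult tendsto_const) (simp add: integral_unique)
qed

text \<open>Each truncated term lies between 0 and its full Gamma integral \<open>b k\<close>, and
  the \<open>b k\<close> are summable like (k + 1)^(-\<sigma>), so Tannery's theorem exchanges limit
  and sum. For fixed n, sum and integral are exchanged by uniform convergence.\<close>

lemma integral_half_theta_powr_tendsto:
  fixes \<sigma> :: real
  assumes \<sigma>: "\<sigma> > 1"
  shows "(\<lambda>n. integral {1 / real (Suc n)..real (Suc n)} (\<lambda>t. half_theta t * t powr (\<sigma> / 2 - 1)))
           \<longlonglongrightarrow> pi powr (- \<sigma> / 2) * Gamma (\<sigma> / 2) * (\<Sum>k. real (Suc k) powr (- \<sigma>))"
proof -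
  define c where "c = (\<lambda>k. pi * (real (Suc k))\<^sup>2)"
  define a where "a = (\<lambda>k n. integral {1 / real (Suc n)..real (Suc n)} (\<lambda>t. exp (- c k * t) * t powr (\<sigma> / 2 - 1)))"
  define b where "b = (\<lambda>k. c k powr (- (\<sigma> / 2)) * Gamma (\<sigma> / 2))"
  have c: "c k > 0" for k by (simp add: c_def)
  have z: "\<sigma> / 2 > 0" using \<sigma> by simp
  have b: "b k = pi powr (- \<sigma> / 2) * Gamma (\<sigma> / 2) * real (Suc k) powr (- \<sigma>)" for k
  proof -
    have "((real (Suc k))\<^sup>2) powr (- (\<sigma> / 2)) = real (Suc k) powr (- \<sigma>)"
      unfolding powr_numeral[OF of_nat_0_le_iff, symmetric] powr_powr by simp
    then show ?thesis by (simp add: b_def c_def powr_mult)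
  qed
  have sb: "summable b" unfolding b using \<sigma> by (intro summable_mult summable_Suc_powr) auto
  have a_le: "norm (a k n) \<le> b k" for k n
    using Gamma_integral_truncated(1,2)[OF z c, of n k] by (simp add: a_def b_def)
  have lim: "(\<lambda>n. a k n) \<longlonglongrightarrow> b k" for k
    using Gamma_integral_truncated(3)[OF z c] by (simp add: a_def b_def)
  have "(\<lambda>n. \<Sum>k. a k n) \<longlonglongrightarrow> suminf b"
    using tannerys_theorem[of a b sequentially b, OF lim _ sb] a_le by (auto simp: always_eventually)
  also have "suminf b = pi powr (- \<sigma> / 2) * Gamma (\<sigma> / 2) * (\<Sum>k. real (Suc k) powr (- \<sigma>))"
    unfolding b using \<sigma> by (intro suminf_mult summable_Suc_powr) auto
  also have "(\<lambda>n. \<Sum>k. a k n) = (\<lambda>n. integral {1 / real (Suc n)..real (Suc n)} (\<lambda>t. half_theta t * t powr (\<sigma> / 2 - 1)))"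
  proof
    fix n
    let ?T = "{1 / real (Suc n)..real (Suc n)}"
    let ?w = "\<lambda>t::real. t powr (\<sigma> / 2 - 1)"
    have T: "t > 0" if "t \<in> ?T" for t
    proof -
      have "0 < 1 / real (Suc n)" by simp
      then show ?thesis using that by (metis atLeastAtMost_iff less_le_trans)
    qed
    have cw: "continuous_on ?T ?w" using T by (intro continuous_intros) force+
    then have "compact (?w ` ?T)" by (intro compact_continuous_image) auto
    then obtain B where B: "B > 0" "\<And>t. t \<in> ?T \<Longrightarrow> \<bar>?w t\<bar> \<le> B"
      by (metis bounded_pos compact_imp_bounded imageI real_norm_def)
    define d where "d = 1 / real (Suc n)"
    have d: "d > 0" by (simp add: d_def)
    have "(\<lambda>k. a k n) sums integral ?T (\<lambda>t. \<Sum>k. exp (- c k * t) * ?w t)"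
      unfolding a_def
    proof (rule integral_sums_M_test(2))
      show "continuous_on ?T (\<lambda>t. exp (- c k * t) * ?w t)" for k by (intro continuous_intros cw)
      show "summable (\<lambda>k. exp (- pi * d) ^ k * B)" using d by (intro summable_mult2 summable_exp_power)
      fix k t assume t: "t \<in> ?T"
      have "exp (- c k * t) \<le> exp (- pi * d * (real (Suc k))\<^sup>2)"
      proof -
        have "d * (pi * (real (Suc k))\<^sup>2) \<le> t * (pi * (real (Suc k))\<^sup>2)"
          using t unfolding d_def by (intro mult_right_mono) auto
        then show ?thesis by (simp add: c_def mult_ac del: of_nat_Suc)
      qed
      also have "\<dots> \<le> exp (- pi * d) ^ k" using d by (intro exp_square_le_power) auto
      finally show "norm (exp (- c k * t) * ?w t) \<le> exp (- pi * d) ^ k * B"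
        unfolding norm_mult using B(2)[OF t] by (intro mult_mono) auto
    qed
    moreover have "(\<Sum>k. exp (- c k * t) * ?w t) = half_theta t * ?w t" if "t \<in> ?T" for t
    proof -
      have "exp (- c k * t) = exp (- pi * t * (real (Suc k))\<^sup>2)" for k by (simp add: c_def mult_ac del: of_nat_Suc)
      then show ?thesis unfolding half_theta_def
        using suminf_mult2[OF summable_half_theta[OF T[OF that]], of "?w t"] by (simp only:)
    qed
    ultimately have "(\<lambda>k. a k n) sums integral ?T (\<lambda>t. half_theta t * ?w t)"
      by (metis (no_types, lifting) Henstock_Kurzweil_Integration.integral_cong)
    then show "(\<Sum>k. a k n) = integral ?T (\<lambda>t. half_theta t * ?w t)" by (simp add: sums_iff)
  qed
  finally show ?thesis .
qed

text \<open>Riemann's folding: t = 1/u carries [1/N, 1] to [1, N], and the transformation law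
  expresses \<open>half_theta (1 / u)\<close> through \<open>half_theta u\<close> and elementary
  terms.\<close>

lemma integral_half_theta_powr_split:
  fixes \<sigma> N :: real
  assumes N: "N \<ge> 1"
  shows "integral {1 / N..N} (\<lambda>t. half_theta t * t powr (\<sigma> / 2 - 1)) =
     integral {1..N} (real_theta_kernel \<sigma>) +
     (integral {1..N} (\<lambda>t. t powr (- (\<sigma> + 1) / 2)) - integral {1..N} (\<lambda>t. t powr (- \<sigma> / 2 - 1))) / 2"
proof -
  let ?f = "\<lambda>t. half_theta t * t powr (\<sigma> / 2 - 1)"
  have N': "1 / N \<le> 1" "0 < 1 / N" using N by auto
  have cf: "continuous_on {a..b} ?f" if "a > 0" for a b
    using that by (intro continuous_intros continuous_on_half_theta) auto
  have "integral {1 / N..1} ?f + integral {1..N} ?f = integral {1 / N..N} ?f"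
    using N N' by (intro Henstock_Kurzweil_Integration.integral_combine integrable_continuous_real cf) auto
  moreover have "integral {1 / N..1} ?f = integral {1..N} (\<lambda>u. half_theta (1 / u) * u powr (- \<sigma> / 2 - 1))"
  proof -
    have "((\<lambda>u. (- (1 / u\<^sup>2)) *\<^sub>R ?f (1 / u)) has_integral (integral {1 / 1..1 / N} ?f - integral {1 / N..1 / 1} ?f)) {1..N}"
    proof (rule has_integral_substitution_general[of "{}" 1 N "\<lambda>u. 1 / u" "1 / N" 1])
      show "continuous_on {1 / N..1} ?f" using N' by (intro cf)
      show "continuous_on {1..N} (\<lambda>u. 1 / u)" by (intro continuous_intros) auto
      show "((\<lambda>u. 1 / u) has_field_derivative - (1 / u\<^sup>2)) (at u within {1..N})" if "u \<in> {1..N} - {}" for u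
        using that by (auto intro!: derivative_eq_intros simp: power2_eq_square)
    qed (use N in \<open>auto simp: field_simps\<close>)
    \<comment> \<open>The substitution reverses orientation, so one of the two integrals runs over
      an empty interval, or a single point if N = 1.\<close>
    moreover have "integral {1 / 1..1 / N} ?f = 0"
    proof (cases "N = 1")
      case False
      then have "{1 / 1..1 / N} = {}" using N by auto
      then show ?thesis by (metis integral_empty)
    qed simp
    ultimately have "integral {1..N} (\<lambda>u. (- (1 / u\<^sup>2)) *\<^sub>R ?f (1 / u)) = - integral {1 / N..1} ?f"
      by (subst integral_unique) auto
    moreover have "(- (1 / u\<^sup>2)) *\<^sub>R ?f (1 / u) = - (half_theta (1 / u) * u powr (- \<sigma> / 2 - 1))" if "u \<in> {1..N}" for u
    proof -
      have u: "u > 0" using that by auto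
      have "1 / u\<^sup>2 = u powr (- 2)" using u by (simp add: powr_minus_divide)
      moreover have "(1 / u) powr (\<sigma> / 2 - 1) = u powr (- (\<sigma> / 2 - 1))"
        using u powr_divide[of 1 u "\<sigma> / 2 - 1"] by (simp only: powr_minus_divide powr_one_eq_one)
      ultimately have "1 / u\<^sup>2 * (1 / u) powr (\<sigma> / 2 - 1) = u powr (- 2) * u powr (- (\<sigma> / 2 - 1))"
        by (simp only:)
      also have "\<dots> = u powr (- \<sigma> / 2 - 1)" unfolding powr_add[symmetric]
        by (rule arg_cong[where f = "\<lambda>p. u powr p"]) simp
      finally show ?thesis by (simp add: mult_ac)
    qed
    ultimately have "integral {1..N} (\<lambda>u. - (half_theta (1 / u) * u powr (- \<sigma> / 2 - 1))) = - integral {1 / N..1} ?f"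
      by (metis (no_types, lifting) Henstock_Kurzweil_Integration.integral_cong)
    then show ?thesis by simp
  qed
  ultimately have "integral {1 / N..N} ?f = integral {1..N} (\<lambda>u. half_theta (1 / u) * u powr (- \<sigma> / 2 - 1)) + integral {1..N} ?f" by simp
  also have "integral {1..N} (\<lambda>u. half_theta (1 / u) * u powr (- \<sigma> / 2 - 1))
     = integral {1..N} (\<lambda>u. half_theta u * u powr (- (\<sigma> + 1) / 2) + (u powr (- (\<sigma> + 1) / 2) - u powr (- \<sigma> / 2 - 1)) / 2)"
  proof (rule Henstock_Kurzweil_Integration.integral_cong)
    fix u assume "u \<in> {1..N}"
    then have u: "u > 0" by auto
    \<comment> \<open>The summand (sqrt u - 1) / 2 is the origin of the polar terms 1 / (\<sigma> -
      1) and 1 / \<sigma>.\<close>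
    have h: "half_theta (1 / u) = sqrt u * half_theta u + (sqrt u - 1) / 2"
      using half_theta_inverse[OF u] by (simp add: field_simps)
    have p: "sqrt u * u powr (- \<sigma> / 2 - 1) = u powr (- (\<sigma> + 1) / 2)"
      unfolding powr_half_sqrt[OF less_imp_le[OF u], symmetric] powr_add[symmetric] by (simp add: field_simps)
    have "half_theta (1 / u) * u powr (- \<sigma> / 2 - 1) =
       half_theta u * (sqrt u * u powr (- \<sigma> / 2 - 1)) + (sqrt u * u powr (- \<sigma> / 2 - 1) - u powr (- \<sigma> / 2 - 1)) / 2"
      unfolding h by (simp add: algebra_simps add_divide_distrib diff_divide_distrib)
    then show "half_theta (1 / u) * u powr (- \<sigma> / 2 - 1) =
       half_theta u * u powr (- (\<sigma> + 1) / 2) + (u powr (- (\<sigma> + 1) / 2) - u powr (- \<sigma> / 2 - 1)) / 2"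
      unfolding p .
  qed
  also have "\<dots> = integral {1..N} (\<lambda>u. half_theta u * u powr (- (\<sigma> + 1) / 2)) +
      (integral {1..N} (\<lambda>t. t powr (- (\<sigma> + 1) / 2)) - integral {1..N} (\<lambda>t. t powr (- \<sigma> / 2 - 1))) / 2"
  proof -
    have "(\<lambda>u. half_theta u * u powr (- (\<sigma> + 1) / 2)) integrable_on {1..N}"
      "(\<lambda>u. u powr (- (\<sigma> + 1) / 2)) integrable_on {1..N}" "(\<lambda>u. u powr (- \<sigma> / 2 - 1)) integrable_on {1..N}"
      by (intro integrable_continuous_real continuous_intros continuous_on_half_theta; auto)+
    then show ?thesis by (simp add: integral_add integral_diff integrable_diff integral_divide)
  qed
  also have "integral {1..N} (\<lambda>u. half_theta u * u powr (- (\<sigma> + 1) / 2)) = integral {1..N} (real_theta_kernel \<sigma>) - integral {1..N} ?f"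
  proof -
    have "(\<lambda>u. half_theta u * u powr (- (\<sigma> + 1) / 2)) integrable_on {1..N}"
      by (intro integrable_continuous_real continuous_intros continuous_on_half_theta; auto)
    moreover have "?f integrable_on {1..N}" by (intro integrable_continuous_real cf) auto
    ultimately show ?thesis unfolding real_theta_kernel_def distrib_left by (simp add: integral_add)
  qed
  finally show ?thesis by simp
qed

lemma integral_powr_tendsto:
  fixes p :: real
  assumes "p > 0"
  shows "(\<lambda>n. integral {1..real (Suc n)} (\<lambda>t. t powr (- p - 1))) \<longlonglongrightarrow> 1 / p"
proof -
  have "integral {1..real (Suc n)} (\<lambda>t. t powr (- p - 1)) = - (real (Suc n) powr (- p) / p) - (- (1 powr (- p) / p))" for n
  proof (intro integral_unique fundamental_theorem_of_calculus)
    fix x assume "x \<in> {1..real (Suc n)}"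
    then have "x > 0" by auto
    then show "((\<lambda>x. - (x powr (- p) / p)) has_vector_derivative x powr (- p - 1)) (at x within {1..real (Suc n)})"
      unfolding has_real_derivative_iff_has_vector_derivative[symmetric]
      using assms by (auto intro!: derivative_eq_intros simp: field_simps)
  qed simp
  moreover have "(\<lambda>n. - (real (Suc n) powr (- p) / p) - (- (1 powr (- p) / p))) \<longlonglongrightarrow> 1 / p"
    using assms by real_asymp
  ultimately show ?thesis by simp
qed

lemma zeta_real_mellin:
  fixes \<sigma> :: real
  assumes \<sigma>: "\<sigma> > 1"
  shows "theta_integral (of_real \<sigma>) = of_real (pi powr (- \<sigma> / 2) * Gamma (\<sigma> / 2) * (\<Sum>k. real (Suc k) powr (- \<sigma>)) - 1 / (\<sigma> - 1) + 1 / \<sigma>)"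
proof -
  let ?Z = "pi powr (- \<sigma> / 2) * Gamma (\<sigma> / 2) * (\<Sum>k. real (Suc k) powr (- \<sigma>))"
  let ?P = "\<lambda>n. (integral {1..real (Suc n)} (\<lambda>t. t powr (- (\<sigma> + 1) / 2)) - integral {1..real (Suc n)} (\<lambda>t. t powr (- \<sigma> / 2 - 1))) / 2"
  have e: "- ((\<sigma> - 1) / 2) - 1 = - (\<sigma> + 1) / 2" "- (\<sigma> / 2) - 1 = - \<sigma> / 2 - 1" by (simp_all add: field_simps)
  have "?P \<longlonglongrightarrow> (1 / ((\<sigma> - 1) / 2) - 1 / (\<sigma> / 2)) / 2"
    using \<sigma>
    by (intro tendsto_divide tendsto_diff tendsto_const integral_powr_tendsto[of "(\<sigma> - 1) / 2", unfolded e]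
        integral_powr_tendsto[of "\<sigma> / 2", unfolded e]) auto
  from tendsto_diff[OF integral_half_theta_powr_tendsto[OF \<sigma>] this]
  have "(\<lambda>n. integral {1..real (Suc n)} (real_theta_kernel \<sigma>)) \<longlonglongrightarrow> ?Z - (1 / ((\<sigma> - 1) / 2) - 1 / (\<sigma> / 2)) / 2"
    by (subst (asm) integral_half_theta_powr_split) auto
  also have "?Z - (1 / ((\<sigma> - 1) / 2) - 1 / (\<sigma> / 2)) / 2 = ?Z - 1 / (\<sigma> - 1) + 1 / \<sigma>"
    using \<sigma> by (simp add: field_simps)
  finally have "(\<lambda>n. complex_of_real (integral {1..real (Suc n)} (real_theta_kernel \<sigma>))) \<longlonglongrightarrow> of_real (?Z - 1 / (\<sigma> - 1) + 1 / \<sigma>)"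
    by (rule tendsto_of_real)
  then show ?thesis using integral_real_theta_kernel_tendsto LIMSEQ_unique by blast
qed

section \<open>Analytic continuation and the theorem\<close>

text \<open>The term \<open>rGamma (s / 2 + 1) / 2\<close> is \<open>rGamma (s / 2) / s\<close> with its singularity at 0 removed.\<close>

definition zeta_ext :: "complex \<Rightarrow> complex" where
  "zeta_ext s = of_real pi powr (s / 2) *
     (rGamma (s / 2) * (1 / (s - 1) + theta_integral s) - rGamma (s / 2 + 1) / 2)"

lemma zeta_ext_holomorphic: "zeta_ext holomorphic_on (- {1})"
  unfolding zeta_ext_def
  by (intro holomorphic_intros holomorphic_on_subset[OF theta_integral_holomorphic_sums(1)]) auto

text \<open>Away from 0 the definition regroups into the form that shows the functional equation:
  the bracket is invariant under s -> 1 - s.\<close>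

lemma zeta_ext_completed:
  assumes "s \<noteq> 0"
  shows "zeta_ext s = of_real pi powr (s / 2) * rGamma (s / 2) * (1 / (s - 1) - 1 / s + theta_integral s)"
proof -
  have "rGamma (s / 2 + 1) / 2 = rGamma (s / 2) / s"
    using rGamma_plus1[of "s / 2"] assms by (simp add: field_simps)
  then show ?thesis by (simp add: zeta_ext_def algebra_simps)
qed

lemma zeta_ext_of_real:
  fixes \<sigma> :: real
  assumes \<sigma>: "\<sigma> > 1"
  shows "zeta_ext (of_real \<sigma>) = (\<Sum>n. of_nat (Suc n) powr (- of_real \<sigma>))"
proof -
  let ?Z = "\<Sum>k. real (Suc k) powr (- \<sigma>)"
  have G: "Gamma (\<sigma> / 2) > 0" using \<sigma> by (intro Gamma_real_pos) auto
  have "of_real pi powr (of_real \<sigma> / 2 :: complex) = of_real (pi powr (\<sigma> / 2))"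
    using powr_of_real[of pi "\<sigma> / 2"] by simp
  moreover have "rGamma (of_real \<sigma> / 2 :: complex) = of_real (rGamma (\<sigma> / 2))"
    using rGamma_complex_of_real[of "\<sigma> / 2"] by simp
  moreover have "1 / (of_real \<sigma> - 1) - 1 / of_real \<sigma> + theta_integral (of_real \<sigma>)
      = of_real (pi powr (- \<sigma> / 2) * Gamma (\<sigma> / 2) * ?Z)"
    unfolding zeta_real_mellin[OF \<sigma>] by simp
  ultimately have "zeta_ext (of_real \<sigma>) = of_real (pi powr (\<sigma> / 2) * rGamma (\<sigma> / 2) * (pi powr (- \<sigma> / 2) * Gamma (\<sigma> / 2) * ?Z))"
    using \<sigma> by (subst zeta_ext_completed) (auto simp del: of_real_mult simp flip: of_real_mult)
  also have "pi powr (\<sigma> / 2) * rGamma (\<sigma> / 2) * (pi powr (- \<sigma> / 2) * Gamma (\<sigma> / 2) * ?Z)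
      = (pi powr (\<sigma> / 2) * pi powr (- \<sigma> / 2)) * (rGamma (\<sigma> / 2) * Gamma (\<sigma> / 2)) * ?Z" by simp
  also have "\<dots> = ?Z" using G by (simp add: powr_add[symmetric] rGamma_inverse_Gamma)
  also have "of_real ?Z = (\<Sum>n. of_nat (Suc n) powr (- of_real \<sigma>) :: complex)"
  proof -
    have eq: "of_nat (Suc n) powr (- of_real \<sigma>) = complex_of_real (real (Suc n) powr (- \<sigma>))" for n
      using powr_of_real[of "real (Suc n)" "- \<sigma>"] by simp
    have "(\<lambda>n. complex_of_real (real (Suc n) powr (- \<sigma>))) sums of_real ?Z"
      using \<sigma> by (intro sums_of_real summable_sums summable_Suc_powr) auto
    then show ?thesis by (simp add: eq sums_iff del: of_nat_Suc)
  qed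
  finally show ?thesis .
qed

text \<open>Identity theorem: both sides are holomorphic for Re s > 1 and agree on the real ray
  above 1, which accumulates at 2.\<close>

lemma zeta_ext_eq_series:
  assumes s: "Re s > 1"
  shows "zeta_ext s = (\<Sum>n. of_nat (Suc n) powr (- s))"
proof -
  let ?S = "{s. Re s > 1}"
  let ?Z = "\<lambda>s. \<Sum>n. of_nat (Suc n) powr (- s) :: complex"
  have Z: "?Z holomorphic_on ?S"
    unfolding holomorphic_on_def field_differentiable_def
    using zeta_series_has_derivative has_field_derivative_at_within by blast
  have "zeta_ext s - ?Z s = 0"
  proof (rule analytic_continuation[of "\<lambda>s. zeta_ext s - ?Z s" ?S "complex_of_real ` {1<..}" 2])
    show "(\<lambda>s. zeta_ext s - ?Z s) holomorphic_on ?S"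
      by (intro holomorphic_intros Z holomorphic_on_subset[OF zeta_ext_holomorphic]) auto
    show "connected ?S" by (intro convex_connected convex_halfspace_Re_gt)
    show "(2::complex) islimpt complex_of_real ` {1<..}"
      unfolding islimpt_sequential
    proof (intro exI[of _ "\<lambda>n. complex_of_real (2 + 1 / real (Suc n))"] conjI allI)
      have "(\<lambda>n. 2 + 1 / real (Suc n)) \<longlonglongrightarrow> 2" by real_asymp
      then show "(\<lambda>n. complex_of_real (2 + 1 / real (Suc n))) \<longlonglongrightarrow> 2"
        using tendsto_of_real[of "\<lambda>n. 2 + 1 / real (Suc n)" 2 sequentially, where ?'a = complex] by simp
      show "complex_of_real (2 + 1 / real (Suc n)) \<in> complex_of_real ` {1<..} - {2}" for n
      proof -
        have "1 / real (Suc n) > 0" by simp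
        then have "2 + 1 / real (Suc n) > 1" "2 + 1 / real (Suc n) \<noteq> 2" by linarith+
        then show ?thesis
          using of_real_eq_iff[of "2 + 1 / real (Suc n)" 2, where ?'a = complex] by (auto simp del: of_real_add of_real_divide)
      qed
    qed
    show "zeta_ext z - ?Z z = 0" if "z \<in> complex_of_real ` {1<..}" for z
      using that zeta_ext_of_real by auto
  qed (use s in \<open>auto simp: open_halfspace_Re_gt\<close>)
  then show ?thesis by simp
qed

text \<open>Resolves the definite description: \<open>zeta_ext\<close>, reset to 0 at 1, is a
  witness, and the identity theorem on the connected punctured plane gives uniqueness.\<close>

lemma riemann_zeta_props:
  "riemann_zeta holomorphic_on (- {1})"
  "\<And>s. Re s > 1 \<Longrightarrow> riemann_zeta s = (\<Sum>n. of_nat (Suc n) powr (- s))"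
  "\<And>s. s \<noteq> 1 \<Longrightarrow> riemann_zeta s = zeta_ext s"
proof -
  let ?P = "\<lambda>f. f holomorphic_on (- {1}) \<and> f 1 = 0 \<and>
      (\<forall>s. 1 < Re s \<longrightarrow> f s = (\<Sum>n. of_nat (Suc n) powr (- s)))"
  define f where "f = (\<lambda>s. if s = 1 then 0 else zeta_ext s)"
  have "f holomorphic_on (- {1})"
    by (rule holomorphic_transform[OF zeta_ext_holomorphic]) (auto simp: f_def)
  then have P: "?P f" using zeta_ext_eq_series by (auto simp: f_def)
  have "g = f" if g: "?P g" for g
  proof
    fix s
    show "g s = f s"
    proof (cases "s = 1")
      case False
      show ?thesis
      proof (rule analytic_continuation_open[of "{s. Re s > 1}" "- {1}" g f])
        show "{s. Re s > 1} \<noteq> {}" by (auto intro!: exI[of _ 2])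
        show "connected (- {1::complex})" by (intro connected_punctured_universe) simp
      qed (use P g False in \<open>auto simp: open_halfspace_Re_gt\<close>)
    qed (use P g in auto)
  qed
  then have eq: "riemann_zeta = f" unfolding riemann_zeta_def by (rule the_equality[of ?P, OF P])
  show "riemann_zeta holomorphic_on (- {1})" using P eq by simp
  show "riemann_zeta s = (\<Sum>n. of_nat (Suc n) powr (- s))" if "Re s > 1" for s using P eq that by simp
  show "riemann_zeta s = zeta_ext s" if "s \<noteq> 1" for s using that unfolding eq by (simp add: f_def)
qed

text \<open>\<open>rGamma (s / 2)\<close> vanishes only at 0 and the negative even integers. At a
  nontrivial zero the symmetric bracket must therefore vanish, and then it vanishes at 1 - s
  too.\<close>

lemma nontrivial_zeta_zero_reflect:
  assumes "nontrivial_zeta_zero s"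
  shows "s \<noteq> 0" "riemann_zeta (1 - s) = 0"
proof -
  have s: "s \<noteq> 1" "riemann_zeta s = 0" "\<And>n::nat. n \<ge> 1 \<Longrightarrow> s \<noteq> - 2 * of_nat n"
    using assms by (auto simp: nontrivial_zeta_zero_def)
  show s0: "s \<noteq> 0"
  proof
    assume "s = 0"
    \<comment> \<open>At 0 only the term with \<open>rGamma 1 = 1\<close> survives, because
      \<open>rGamma 0 = 0\<close>.\<close>
    then have "riemann_zeta s = - 1 / 2" using riemann_zeta_props(3)[of 0] by (simp add: zeta_ext_def)
    then show False using s(2) by simp
  qed
  have "s / 2 \<notin> \<int>\<^sub>\<le>\<^sub>0"
  proof
    assume "s / 2 \<in> \<int>\<^sub>\<le>\<^sub>0"
    then obtain n where n: "s / 2 = - of_nat n" by (auto elim!: nonpos_Ints_cases')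
    then have "s = - 2 * of_nat n" by (simp add: field_simps)
    then show False using s(3)[of n] s0 by (cases n) auto
  qed
  then have "rGamma (s / 2) \<noteq> 0" by (simp add: rGamma_eq_zero_iff)
  then have "1 / (s - 1) - 1 / s + theta_integral s = 0"
    using s riemann_zeta_props(3)[of s] zeta_ext_completed[OF s0] by (auto simp: powr_eq_0_iff)
  moreover have "1 / (1 - s - 1) - 1 / (1 - s) = 1 / (s - 1) - 1 / s"
    using s s0 by (simp add: field_simps)
  ultimately have "1 / (1 - s - 1) - 1 / (1 - s) + theta_integral (1 - s) = 0"
    by (simp only: theta_integral_symmetric)
  then show "riemann_zeta (1 - s) = 0"
    using riemann_zeta_props(3)[of "1 - s"] zeta_ext_completed[of "1 - s"] s s0
    by (simp only: mult_zero_right) auto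
qed

theorem theorem5p1:
  assumes "\<exists>C::real. C > 0 \<and>
    (\<forall>\<^sub>F X in at_top.
       E_tilde X \<le> 5/6 * E_tilde (X powr (3/4)) + C * X powr (1/2) * ln X)"
  shows "\<forall>s. nontrivial_zeta_zero s \<longrightarrow> Re s = 1/2"
proof -
  obtain K where K: "K > 0" "\<forall>\<^sub>F n in sequentially. \<bar>E_psi (real n)\<bar> \<le> K * (real n powr (1/2) * ln (real n))"
    using E_psi_bound[OF assms] by blast
  have zero_free: "riemann_zeta s \<noteq> 0" if s: "Re s > 1/2" "s \<noteq> 1" for s
  proof -
    \<comment> \<open>Strictly between 1/2 and Re s, so that n^b absorbs the logarithm; the cap 3/4
      keeps b below 1.\<close>
    define b where "b = min ((Re s + 1/2) / 2) (3/4)"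
    have b: "b > 1/2" "b < 1" "Re s > b" using s by (auto simp: b_def min_def)
    have "\<forall>\<^sub>F n in sequentially. real n powr (1/2) * ln (real n) \<le> real n powr b"
      using b(1) by real_asymp
    then have "\<forall>\<^sub>F n in sequentially. \<bar>E_psi (real n)\<bar> \<le> K * real n powr b"
      using K(2)
    proof eventually_elim
      case (elim n)
      then show ?case using K(1) by (smt (verit) mult_left_mono)
    qed
    then show ?thesis
      using b s by (intro zeta_zero_free[OF riemann_zeta_props(1,2), of b K s]) auto
  qed
  show ?thesis
  proof (intro allI impI)
    fix s assume nz: "nontrivial_zeta_zero s"
    note refl = nontrivial_zeta_zero_reflect[OF nz]
    have "\<not> Re s > 1/2" using zero_free[of s] nz by (auto simp: nontrivial_zeta_zero_def)
    \<comment> \<open>The reflected zero 1 - s would have real part above 1/2, and it differs from 1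
      because s is not 0.\<close>
    moreover have "\<not> Re s < 1/2" using zero_free[of "1 - s"] refl by auto
    ultimately show "Re s = 1/2" by linarith
  qed
qed

end
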